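(* For every $\epsilon > 0$ there exists $n_0(\epsilon)$ such that for every integer $n \geq n_0(\epsilon)$ the following holds: if $X \subset \mathbb{R}^3$ is a finite set of points in general position with $|X| \geq 2^{\epsilon n}$, then $X$ contains $n$ points in convex position. In other words, $ES_3(n) = 2^{o(n)}$ as $n \to \infty$.
   Context: A set $X \subset \mathbb{R}^d$ with $|X| \geq d+1$ is in general position if no $d+1$ points of $X$ lie on a common affine hyperplane. A finite point set is in convex position if its points are the vertices of a convex polytope (equivalently, no point lies in the convex hull of the others). $ES_d(n)$ denotes the smallest integer $N$ such that every set of $N$ points in general position in $\mathbb{R}^d$ contains $n$ points in convex position. *)

theory Defs
  imports "HOL-Analysis.Analysis" "HOL-Library.Landau_Symbols"
begin

definition general_position :: "(real ^ 'n::finite) set \<Rightarrow> bool" where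
  "general_position X \<longleftrightarrow>
     (finite X \<longrightarrow> CARD('n) + 1 \<le> card X) \<and>
     \<not> (\<exists>Y a b. Y \<subseteq> X \<and> card Y = CARD('n) + 1 \<and> a \<noteq> 0 \<and> Y \<subseteq> {x. a \<bullet> x = b})"

definition convex_position :: "'a::euclidean_space set \<Rightarrow> bool" where
  "convex_position Y \<longleftrightarrow> (\<exists>P. polytope P \<and> Y = {v. v extreme_point_of P})"

lemma convex_position_iff:
  fixes Y :: "'a::euclidean_space set"
  shows "convex_position Y \<longleftrightarrow> finite Y \<and> (\<forall>x\<in>Y. x \<notin> convex hull (Y - {x}))"
proof
  assume "convex_position Y"
  then obtain P V where P: "finite V" "P = convex hull V" and Y: "Y = {v. v extreme_point_of P}"
    unfolding convex_position_def polytope_def by blast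
  have fin: "finite Y"
    using finite_subset[OF extreme_points_of_convex_hull[of V] P(1)] P(2) Y by simp
  have PY: "P = convex hull Y"
    unfolding P(2) Y by (rule Krein_Milman_polytope[OF P(1)])
  have "x \<notin> convex hull (Y - {x})" if "x \<in> Y" for x
  proof
    assume "x \<in> convex hull (Y - {x})"
    then have "convex hull Y = convex hull (Y - {x})"
      using hull_redundant[of x convex "Y - {x}"] insert_Diff[OF that] by metis
    then have "x extreme_point_of (convex hull (Y - {x}))"
      using that PY Y mem_Collect_eq by metis
    then show False
      using extreme_point_of_convex_hull[of x "Y - {x}"] by blast
  qed
  with fin show "finite Y \<and> (\<forall>x\<in>Y. x \<notin> convex hull (Y - {x}))"
    by blast
next
  assume *: "finite Y \<and> (\<forall>x\<in>Y. x \<notin> convex hull (Y - {x}))"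
  then have "Y = {v. v extreme_point_of (convex hull Y)}"
    using extreme_point_of_convex_hull_convex_independent[of Y] finite_imp_compact[of Y] by auto
  moreover have "polytope (convex hull Y)"
    using * polytope_def by blast
  ultimately show "convex_position Y"
    unfolding convex_position_def by (intro exI[of _ "convex hull Y"] conjI)
qed

text \<open>
  The dimension \<open>d\<close> is the cardinality of the index type. The bound \<open>CARD('n) + 1 \<le> N\<close> is
  needed because sets with at most \<open>d\<close> points are never in general position, so that smaller
  \<open>N\<close> would qualify vacuously.
\<close>

definition ES :: "'n::finite itself \<Rightarrow> nat \<Rightarrow> nat" where
  "ES _ n = (LEAST N. CARD('n) + 1 \<le> N \<and>
     (\<forall>X :: (real ^ 'n) set. finite X \<and> card X = N \<and> general_position X \<longrightarrow>
        (\<exists>Y\<subseteq>X. card Y = n \<and> convex_position Y)))"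

end

theory Submission
  imports Defs "HOL-Library.Ramsey"
begin

text \<open>
  By centerpoints and Ramsey's theorem, a positive fraction of \<open>X\<close> splits into a constant number of
  clusters such that all transversals have the combinatorial type of points on the moment curve;
  hence no plane alternates sides five times along the clusters.

  Project a cluster \<open>Z\<close> to the plane from a point of the line through two points \<open>h\<close>, \<open>l\<close> of an
  earlier and a later cluster, outside the segment \<open>hl\<close>. By the asymmetric Erdos-Szekeres theorem
  either some \<open>n\<close> points of \<open>Z\<close> are in convex position or \<open>Z\<close> contains a cap of linear size \<open>\<delta> n\<close>,
  whose supporting planes all have \<open>h\<close>
      and \<open>l\<close> below them. For a well chosen centre of
  projection each of these planes also has below it a second earlier and a second later
  point, out of two candidates each. So among any seven clusters there are five,
  \<open>a < b < i < c < d\<close>, such that cluster \<open>i\<close> contains a linear-size cap all of whose supporting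
  planes lie above representatives of \<open>a\<close>, \<open>b\<close>, \<open>c\<close>, \<open>d\<close>. Ramsey's theorem for 5-tuples makes
  this hold for all 5-tuples of a large subfamily. A plane above \<open>a\<close>, \<open>b\<close>, \<open>c\<close>, \<open>d\<close> through a
  point of cluster \<open>i\<close> lies above all clusters between \<open>a\<close>
      and \<open>b\<close> and between \<open>c\<close> and \<open>d\<close>, so
  the caps of about \<open>1 / \<delta>\<close> clusters together are in convex position.
\<close>

text \<open>Otherwise the Ramsey number of the library would shadow the \<open>ES\<close> of the theorem.\<close>

hide_const (open) Ramsey.ES

subsection \<open>Affine forms and orientations in space\<close>

text \<open>Six times the signed volume of the tetrahedron \<open>a b c d\<close>: its sign is the
  orientation of the quadruple, and it vanishes exactly for coplanar points.\<close>

definition orient :: "real^3 \<Rightarrow> real^3 \<Rightarrow> real^3 \<Rightarrow> real^3 \<Rightarrow> real" where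
  "orient a b c d = det (vector [b - a, c - a, d - a] :: real^3^3)"

text \<open>The vector \<open>u\<close> may be zero, so that affine forms are a vector space; planes
  are later compared through differences of their forms.\<close>

definition affine_form :: "(real^3 \<Rightarrow> real) \<Rightarrow> bool" where
  "affine_form f \<longleftrightarrow> (\<exists>u b. f = (\<lambda>x. u \<bullet> x - b))"

lemma orient_coords:
  "orient a b c d =
     (b$1 - a$1) * (c$2 - a$2) * (d$3 - a$3) + (b$2 - a$2) * (c$3 - a$3) * (d$1 - a$1)
   + (b$3 - a$3) * (c$1 - a$1) * (d$2 - a$2) - (b$1 - a$1) * (c$3 - a$3) * (d$2 - a$2)
   - (b$2 - a$2) * (c$1 - a$1) * (d$3 - a$3) - (b$3 - a$3) * (c$2 - a$2) * (d$1 - a$1)"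
  by (simp add: orient_def det_3)

lemma affine_form_inner: "affine_form (\<lambda>x. u \<bullet> x - b)"
  unfolding affine_form_def by blast

lemma affine_form_scale:
  assumes "affine_form f"
  shows "affine_form (\<lambda>x. k * f x)"
proof -
  obtain u b where "f = (\<lambda>x. u \<bullet> x - b)"
    using assms unfolding affine_form_def by blast
  then have "(\<lambda>x. k * f x) = (\<lambda>x. (k *\<^sub>R u) \<bullet> x - k * b)"
    by (auto simp: algebra_simps)
  then show ?thesis
    unfolding affine_form_def by blast
qed

lemma affine_form_diff: "affine_form f \<Longrightarrow> affine_form g \<Longrightarrow>
    affine_form (\<lambda>x. f x - g x)"
proof -
  assume "affine_form f" "affine_form g"
  then obtain u b v c where "f = (\<lambda>x. u \<bullet> x - b)" "g = (\<lambda>x. v \<bullet> x - c)"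
    unfolding affine_form_def by blast
  then have "(\<lambda>x. f x - g x) = (\<lambda>x. (u - v) \<bullet> x - (b - c))"
    by (auto simp: inner_diff_left)
  then show ?thesis
    unfolding affine_form_def by blast
qed

lemma affine_form_uminus: "affine_form f \<Longrightarrow> affine_form (\<lambda>x. - f x)"
  using affine_form_scale[of f "-1"] by simp

lemma affine_form_orient: "affine_form (orient a b c)"
proof -
  \<comment> \<open>The cross product of \<open>b - a\<close> and \<open>c - a\<close>.\<close>
  define u :: "real^3" where "u = vector
    [(b$2 - a$2) * (c$3 - a$3) - (b$3 - a$3) * (c$2 - a$2),
     (b$3 - a$3) * (c$1 - a$1) - (b$1 - a$1) * (c$3 - a$3),
     (b$1 - a$1) * (c$2 - a$2) - (b$2 - a$2) * (c$1 - a$1)]"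
  have "orient a b c = (\<lambda>x. u \<bullet> x - u \<bullet> a)"
    by (rule ext) (simp add: orient_coords u_def inner_vec_def sum_3 algebra_simps)
  then show ?thesis
    unfolding affine_form_def by blast
qed

lemma orient_swap23: "orient a c b d = - orient a b c d"
  and orient_swap34: "orient a b d c = - orient a b c d"
  by (simp_all add: orient_coords algebra_simps)

lemma orient_same [simp]:
  "orient a a c d = 0" "orient a b a d = 0" "orient a b c a = 0"
  "orient a b b d = 0" "orient a b c b = 0" "orient a b c c = 0"
  by (simp_all add: orient_coords)

text \<open>Each identity expands a determinant of order four with two equal rows. With twelve plain
  real variables the polynomial arithmetic stays small; coordinate differences are substituted
  afterwards.\<close>

lemma det3_Cramer:
  fixes b1 b2 b3 c1 c2 c3 d1 d2 d3 e1 e2 e3 :: real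
  shows "(c1 * d2 * e3 + c2 * d3 * e1 + c3 * d1 * e2 - c1 * d3 * e2 - c2 * d1 * e3 - c3 * d2 * e1) * b1
     - (b1 * d2 * e3 + b2 * d3 * e1 + b3 * d1 * e2 - b1 * d3 * e2 - b2 * d1 * e3 - b3 * d2 * e1) * c1
     + (b1 * c2 * e3 + b2 * c3 * e1 + b3 * c1 * e2 - b1 * c3 * e2 - b2 * c1 * e3 - b3 * c2 * e1) * d1
     - (b1 * c2 * d3 + b2 * c3 * d1 + b3 * c1 * d2 - b1 * c3 * d2 - b2 * c1 * d3 - b3 * c2 * d1) * e1 = 0"
    and "(c1 * d2 * e3 + c2 * d3 * e1 + c3 * d1 * e2 - c1 * d3 * e2 - c2 * d1 * e3 - c3 * d2 * e1) * b2
     - (b1 * d2 * e3 + b2 * d3 * e1 + b3 * d1 * e2 - b1 * d3 * e2 - b2 * d1 * e3 - b3 * d2 * e1) * c2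
     + (b1 * c2 * e3 + b2 * c3 * e1 + b3 * c1 * e2 - b1 * c3 * e2 - b2 * c1 * e3 - b3 * c2 * e1) * d2
     - (b1 * c2 * d3 + b2 * c3 * d1 + b3 * c1 * d2 - b1 * c3 * d2 - b2 * c1 * d3 - b3 * c2 * d1) * e2 = 0"
    and "(c1 * d2 * e3 + c2 * d3 * e1 + c3 * d1 * e2 - c1 * d3 * e2 - c2 * d1 * e3 - c3 * d2 * e1) * b3
     - (b1 * d2 * e3 + b2 * d3 * e1 + b3 * d1 * e2 - b1 * d3 * e2 - b2 * d1 * e3 - b3 * d2 * e1) * c3
     + (b1 * c2 * e3 + b2 * c3 * e1 + b3 * c1 * e2 - b1 * c3 * e2 - b2 * c1 * e3 - b3 * c2 * e1) * d3
     - (b1 * c2 * d3 + b2 * c3 * d1 + b3 * c1 * d2 - b1 * c3 * d2 - b2 * c1 * d3 - b3 * c2 * d1) * e3 = 0"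
  by (simp_all add: algebra_simps)

text \<open>Multilinear expansion of the determinant of \<open>c - b\<close>, \<open>d - b\<close>,
  \<open>e - b\<close>: the terms containing \<open>b\<close> twice vanish.\<close>

lemma det3_diff:
  fixes b1 b2 b3 c1 c2 c3 d1 d2 d3 e1 e2 e3 :: real
  shows "(c1 - b1) * (d2 - b2) * (e3 - b3) + (c2 - b2) * (d3 - b3) * (e1 - b1) + (c3 - b3) * (d1 - b1) * (e2
        - b2) - (c1 - b1) * (d3 - b3) * (e2 - b2) - (c2 - b2) * (d1 - b1) * (e3 - b3) - (c3 - b3) * (d2 - b2) * (e1 - b1)
   = (c1 * d2 * e3 + c2 * d3 * e1 + c3 * d1 * e2 - c1 * d3 * e2 - c2 * d1 * e3 - c3 * d2 * e1)
     - (b1 * d2 * e3 + b2 * d3 * e1 + b3 * d1 * e2 - b1 * d3 * e2 - b2 * d1 * e3 - b3 * d2 * e1)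
     + (b1 * c2 * e3 + b2 * c3 * e1 + b3 * c1 * e2 - b1 * c3 * e2 - b2 * c1 * e3 - b3 * c2 * e1)
     - (b1 * c2 * d3 + b2 * c3 * d1 + b3 * c1 * d2 - b1 * c3 * d2 - b2 * c1 * d3 - b3 * c2 * d1)"
  by (simp add: algebra_simps)

text \<open>Five points of space have an affine dependency whose coefficients are, with alternating
  signs, the orientations of the remaining four points. Affine forms respect affine
  dependencies.\<close>

lemma affine_form_Cramer:
  assumes "affine_form f"
  shows "orient b c d e * f a - orient a c d e * f b + orient a b d e * f c
    - orient a b c e * f d + orient a b c d * f e = 0"
proof -
  obtain u k where f: "f = (\<lambda>x. u \<bullet> x - k)"
    using assms unfolding affine_form_def by blast
  \<comment> \<open>\<open>K\<close> is linear in \<open>y\<close>. It maps the constant 1 to the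
    coefficient of \<open>a\<close> and kills the coordinates relative to \<open>a\<close>, and
    every affine form is a combination of these.\<close>
  define K where "K y = orient a c d e * y b - orient a b d e * y c
    + orient a b c e * y d - orient a b c d * y e" for y :: "real^3 \<Rightarrow> real"
  have 1: "orient b c d e = K (\<lambda>p. 1)"
    unfolding K_def orient_coords mult_1_right
    using det3_diff[of "c$1 - a$1" "b$1 - a$1" "d$2 - a$2" "b$2 - a$2" "e$3 - a$3" "b$3 - a$3"
      "c$2 - a$2" "d$3 - a$3" "e$1 - a$1" "c$3 - a$3" "d$1 - a$1" "e$2 - a$2"] by simp
  have "K (\<lambda>p. p$1 - a$1) = 0" "K (\<lambda>p. p$2 - a$2) = 0" "K (\<lambda>p. p$3 - a$3) = 0"
    unfolding K_def orient_coords by (fact det3_Cramer)+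
  moreover have "K f - f a * K (\<lambda>p. 1)
      = u$1 * K (\<lambda>p. p$1 - a$1) + u$2 * K (\<lambda>p. p$2 - a$2) +
          u$3 * K (\<lambda>p. p$3 - a$3)"
    unfolding f K_def by (simp add: inner_vec_def sum_3 algebra_simps)
  ultimately have "K f = f a * orient b c d e"
    using 1 by simp
  then show ?thesis
    by (simp add: K_def algebra_simps)
qed

lemma orient_affine4:
  "orient a b c ((1 - t) *\<^sub>R d + t *\<^sub>R e) = (1 - t) * orient a b c d + t * orient a b c e"
  by (simp add: orient_coords algebra_simps)

lemma det_eq_0_kernel:
  fixes A :: "real^'n^'n"
  assumes "det A = 0"
  obtains v where "v \<noteq> 0" "A *v v = 0"
proof -
  have "\<not> inj ((*v) A)"
    using assms det_nz_iff_inj[OF matrix_vector_mul_linear, of A]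
    by (simp add: matrix_of_matrix_vector_mul)
  then obtain x y where "A *v x = A *v y" "x \<noteq> y"
    unfolding inj_def by blast
  then show ?thesis
    using that[of "x - y"] by (simp add: matrix_vector_mult_diff_distrib)
qed

text \<open>A kernel vector of the transposed matrix holds the coefficients of a linear dependency
  of the differences; the coefficient of \<open>a\<close> balances the sum to zero.\<close>

lemma orient_eq_0_dependency:
  assumes "orient a b c d = 0"
  obtains w x y z where "w + x + y + z = 0" "\<not> (w = 0 \<and> x = 0 \<and> y = 0 \<and> z = 0)"
    "w *\<^sub>R a + x *\<^sub>R b + y *\<^sub>R c + z *\<^sub>R d = 0"
proof -
  let ?A = "vector [b - a, c - a, d - a] :: real^3^3"
  have "det (transpose ?A) = 0"
    using assms by (simp add: orient_def)
  then obtain k where k: "k \<noteq> 0" "transpose ?A *v k = 0"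
    by (rule det_eq_0_kernel)
  have "k$1 *\<^sub>R (b - a) + k$2 *\<^sub>R (c - a) + k$3 *\<^sub>R (d - a) = 0"
    using k(2) by (simp add: vec_eq_iff matrix_vector_mult_def transpose_def sum_3 algebra_simps)
  then have "(-(k$1) - k$2 - k$3) *\<^sub>R a + k$1 *\<^sub>R b + k$2 *\<^sub>R c + k$3 *\<^sub>R d = 0"
    by (simp add: algebra_simps)
  moreover have "\<not> (k$1 = 0 \<and> k$2 = 0 \<and> k$3 = 0)"
    using k(1) by (simp add: vec_eq_iff forall_3)
  ultimately show ?thesis
    using that[of "-(k$1) - k$2 - k$3" "k$1" "k$2" "k$3"] by auto
qed

text \<open>A kernel vector of the matrix is orthogonal to all three differences, hence normal to a
  common plane. The points may coincide.\<close>

lemma orient_eq_0_coplanar: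
  assumes "orient a b c d = 0"
  obtains u k where "u \<noteq> 0" "u \<bullet> a = k" "u \<bullet> b = k" "u \<bullet> c =
      k" "u \<bullet> d = k"
proof -
  let ?A = "vector [b - a, c - a, d - a] :: real^3^3"
  have "det ?A = 0"
    using assms by (simp add: orient_def)
  then obtain u where u: "u \<noteq> 0" "?A *v u = 0"
    by (rule det_eq_0_kernel)
  have "u \<bullet> (b - a) = 0" "u \<bullet> (c - a) = 0" "u \<bullet> (d - a) = 0"
    using u(2) by (simp_all add: vec_eq_iff matrix_vector_mult_def forall_3 sum_3 inner_vec_def algebra_simps)
  then show ?thesis
    using that[of u "u \<bullet> a"] u(1) by (simp add: inner_diff_right)
qed

lemma general_position_orient:
  fixes X :: "(real^3) set"
  assumes "general_position X" "{a, b, c, d} \<subseteq> X" "distinct [a, b, c, d]"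
  shows "orient a b c d \<noteq> 0"
proof
  assume "orient a b c d = 0"
  then obtain u k where u: "u \<noteq> 0" "u \<bullet> a = k" "u \<bullet> b = k" "u \<bullet> c =
      k" "u \<bullet> d = k"
    by (rule orient_eq_0_coplanar)
  have "card {a, b, c, d} = CARD(3) + 1" "{a, b, c, d} \<subseteq> {x. u \<bullet> x = k}"
    using assms(3) u by auto
  then show False
    using assms(1,2) u(1) unfolding general_position_def by blast
qed

section \<open>Sign changes of affine forms along cyclic sequences\<close>

text \<open>The order type of points along the moment curve; the sign of \<open>\<sigma>\<close>
  distinguishes the two mirror images.\<close>

definition cyclic_points :: "real \<Rightarrow> (nat \<Rightarrow> real^3) \<Rightarrow> nat \<Rightarrow> bool" where
  "cyclic_points \<sigma> p m \<longleftrightarrow> (\<forall>i j k l. i < j \<longrightarrow> j < k \<longrightarrow> k < l \<longrightarrow> l < m \<longrightarrow>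
     \<sigma> * orient (p i) (p j) (p k) (p l) > 0)"

lemma cyclic_pointsD:
  "cyclic_points \<sigma> p m \<Longrightarrow> i < j \<Longrightarrow> j < k \<Longrightarrow>
      k < l \<Longrightarrow> l < m \<Longrightarrow>
     \<sigma> * orient (p i) (p j) (p k) (p l) > 0"
  unfolding cyclic_points_def by blast

text \<open>In the affine dependency of \<open>a\<close>, \<open>b\<close>, \<open>c\<close>,
  \<open>d\<close>, \<open>e\<close> the coefficients alternate in sign. With alternating values of
  \<open>f\<close> all five terms are nonnegative and add up to zero, so each of them vanishes. Weak
  inequalities allow zeros to count for either sign; a single strict value then gives a
  contradiction.\<close>

lemma no_five_alternations:
  assumes f: "affine_form f"
    and o: "\<sigma> * orient b c d e > 0" "\<sigma> * orient a c d e > 0"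
        "\<sigma> * orient a b d e > 0"
      "\<sigma> * orient a b c e > 0" "\<sigma> * orient a b c d > 0"
    and sgn: "f a \<ge> 0" "f b \<le> 0" "f c \<ge> 0" "f d \<le> 0" "f e \<ge> 0"
  shows "f a = 0 \<and> f b = 0 \<and> f c = 0 \<and> f d = 0 \<and> f e = 0"
proof -
  define A B C D E where ABC: "A = \<sigma> * orient b c d e" "B = \<sigma> * orient a c d e" "C =
      \<sigma> * orient a b d e"
    "D = \<sigma> * orient a b c e" "E = \<sigma> * orient a b c d"
  note pos = o[folded ABC]
  have "A * f a - B * f b + C * f c - D * f d + E * f e
      = \<sigma> * (orient b c d e * f a - orient a c d e * f b + orient a b d e * f c
    - orient a b c e * f d + orient a b c d * f e)"
    unfolding ABC by (simp only: distrib_left right_diff_distrib mult.assoc)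
  also have "\<dots> = 0"
    using affine_form_Cramer[OF f, of b c d e a] by simp
  finally have "A * f a - B * f b + C * f c - D * f d + E * f e = 0" .
  moreover have "A * f a \<ge> 0" "B * f b \<le> 0" "C * f c \<ge> 0" "D * f d \<le> 0" "E * f e \<ge> 0"
    using pos sgn by (simp_all add: mult_nonneg_nonpos)
  ultimately have "A * f a = 0" "B * f b = 0" "C * f c = 0" "D * f d = 0" "E * f e = 0"
    by linarith+
  then show ?thesis
    using pos by (simp only: mult_eq_0_iff) linarith
qed

lemma cyclic_points_alternation:
  assumes "cyclic_points \<sigma> p m" "affine_form f"
    and "i < j" "j < k" "k < l" "l < q" "q < m"
    and "f (p i) \<ge> 0" "f (p j) \<le> 0" "f (p k) \<ge> 0" "f (p l) \<le> 0" "f (p q) \<ge> 0"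
  shows "f (p i) = 0 \<and> f (p j) = 0 \<and> f (p k) = 0 \<and> f (p l) = 0 \<and> f (p q) = 0"
proof -
  have lt: "i < k" "i < l" "j < l" "j < q" "k < q" "l < m"
    using assms(3-7) by linarith+
  note D = cyclic_pointsD[OF assms(1)]
  show ?thesis
    by (rule no_five_alternations[OF assms(2)
        D[OF assms(4,5,6,7)] D[OF lt(1) assms(5,6,7)] D[OF assms(3) lt(3) assms(6,7)]
        D[OF assms(3,4) lt(5) assms(7)] D[OF assms(3,4,5) lt(6)] assms(8-12)])
qed

subsection \<open>Clusters of constant orientation\<close>

text \<open>At most \<open>k\<close> sets each omit fewer than the \<open>k\<close>-th part of
  \<open>A\<close>, so together they cannot omit all of it.\<close>

lemma Inter_large_subsets_nonempty:
  fixes A :: "'a set"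
  assumes A: "finite A" "A \<noteq> {}" and G: "finite G" "card G \<le> k"
    and large: "\<And>B. B \<in> G \<Longrightarrow> B \<subseteq> A \<and> k * card (A - B) < card A"
  shows "A \<inter> \<Inter>G \<noteq> {}"
proof (cases "G = {}")
  case True
  then show ?thesis using A by auto
next
  case False
  have "k * card (\<Union>B\<in>G. A - B) \<le> k * (\<Sum>B\<in>G. card (A - B))"
    using card_UN_le[OF G(1), of "\<lambda>B. A - B"] by simp
  also have "\<dots> = (\<Sum>B\<in>G. k * card (A - B))"
    by (simp add: sum_distrib_left)
  also have "\<dots> < (\<Sum>B\<in>G. card A)"
    using large False G(1) by (intro sum_strict_mono) auto
  also have "\<dots> \<le> k * card A"
    using G(2) by simp
  finally have "(\<Union>B\<in>G. A - B) \<noteq> A"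
    by auto
  then show ?thesis
    by auto
qed

text \<open>Helly's theorem for the hulls of all subsets omitting less than a fraction
  \<open>1 / (d + 1)\<close> of \<open>A\<close>: any \<open>d + 1\<close> of these subsets share a
  point of \<open>A\<close>. A closed half-space through a common point \<open>c\<close> of the
  hulls cannot contain too few points, since otherwise the hull of the points outside it would
  contain \<open>c\<close>.\<close>

lemma centerpoint_exists:
  fixes A :: "'a::euclidean_space set"
  assumes A: "finite A" "A \<noteq> {}"
  obtains c where "\<And>u b. b \<le> u \<bullet> c \<Longrightarrow>
      card A \<le> (DIM('a) + 1) * card {x \<in> A. b \<le> u \<bullet> x}"
proof -
  define S where "S = {B. B \<subseteq> A \<and> (DIM('a) + 1) * card (A - B) < card A}"
  have finS: "finite S"
    using A unfolding S_def by auto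
  have Inter: "\<Inter>T \<noteq> {}" if T: "T \<subseteq> (hull) convex ` S" "card T \<le> DIM('a) +
      1" for T
  proof -
    \<comment> \<open>Several subsets can have the same hull; \<open>G\<close> keeps one for each
      hull, so that it is no larger than \<open>T\<close>.\<close>
    obtain G where G: "G \<subseteq> S" "inj_on ((hull) convex) G" "T = (hull) convex ` G"
      using T(1) by (auto simp: subset_image_inj)
    have "card G \<le> DIM('a) + 1"
      using T(2) G(2,3) by (simp add: card_image)
    then have "A \<inter> \<Inter>G \<noteq> {}"
      using G(1) finite_subset[OF G(1) finS]
      by (intro Inter_large_subsets_nonempty[OF A, where k = "DIM('a) + 1"]) (auto simp: S_def)
    then obtain x where "x \<in> \<Inter>G"
      by blast
    then have "x \<in> \<Inter>T"
      unfolding G(3) by (auto intro: hull_inc)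
    then show ?thesis by blast
  qed
  have "\<Inter>((hull) convex ` S) \<noteq> {}"
  proof (cases "card ((hull) convex ` S) \<le> DIM('a) + 1")
    case True
    then show ?thesis using Inter by blast
  next
    case False
    show ?thesis
    proof (rule Helly)
      show "DIM('a) + 1 \<le> card ((hull) convex ` S)"
        using False by linarith
      show "\<forall>s\<in>(hull) convex ` S. convex s"
        by (simp add: convex_convex_hull)
      show "\<Inter>T \<noteq> {}" if "T \<subseteq> (hull) convex ` S" "card T = DIM('a) + 1" for T
        by (rule Inter[OF that(1)]) (simp add: that(2))
    qed
  qed
  then obtain c where c: "\<And>B. B \<in> S \<Longrightarrow> c \<in> convex hull B"
    by auto
  have "card A \<le> (DIM('a) + 1) * card {x \<in> A. b \<le> u \<bullet> x}"
      if "b \<le> u \<bullet> c" for u b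
  proof (rule ccontr)
    assume less: "\<not> ?thesis"
    have "A - {x \<in> A. u \<bullet> x < b} = {x \<in> A. b \<le> u \<bullet> x}"
      by auto
    then have "{x \<in> A. u \<bullet> x < b} \<in> S"
      using less unfolding S_def by (simp only: mem_Collect_eq) auto
    then have "c \<in> convex hull {x \<in> A. u \<bullet> x < b}"
      by (rule c)
    also have "\<dots> \<subseteq> {x. u \<bullet> x < b}"
      by (rule hull_minimal) (auto intro: convex_halfspace_lt)
    finally show False
      using that by simp
  qed
  then show ?thesis
    by (rule that)
qed

definition on_side :: "bool \<Rightarrow> real \<Rightarrow> bool" where
  "on_side s r \<longleftrightarrow> (if s then 0 < r else r < 0)"

lemma on_side_uminus: "on_side s (- r) \<longleftrightarrow> on_side (\<not> s) r"
  by (auto simp: on_side_def)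

lemma general_position_plane_card:
  fixes X :: "(real^3) set"
  assumes "general_position X" "finite X" "u \<noteq> 0"
  shows "card {x \<in> X. u \<bullet> x = b} \<le> 3"
proof (rule ccontr)
  assume "\<not> ?thesis"
  then have "4 \<le> card {x \<in> X. u \<bullet> x = b}"
    by simp
  then obtain Y where "Y \<subseteq> {x \<in> X. u \<bullet> x = b}" "card Y = 4"
    by (rule obtain_subset_with_card_n)
  then have "Y \<subseteq> X" "card Y = CARD(3) + 1" "Y \<subseteq> {x. u \<bullet> x = b}"
    by auto
  then show False
    using assms(1,3) unfolding general_position_def by blast
qed

text \<open>A closed side of a plane through the centerpoint has at least \<open>2 * m\<close>
  points of \<open>A\<close>. General position leaves at most three on the plane itself, and
  \<open>3 \<le> m\<close>.\<close>

lemma centerpoint_plane_side: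
  fixes X :: "(real^3) set"
  assumes X: "general_position X" "finite X" and A: "A \<subseteq> X" "8 * m \<le> card A" "3 \<le> m"
    and c: "\<And>u b. b \<le> u \<bullet> c \<Longrightarrow>
        card A \<le> 4 * card {x \<in> A. b \<le> u \<bullet> x}"
    and u: "u \<noteq> 0" "u \<bullet> c = b"
  shows "m \<le> card {x \<in> A. on_side s (u \<bullet> x - b)}"
proof -
  have pos: "m \<le> card {x \<in> A. 0 < v \<bullet> x - k}"
      if v: "v \<noteq> 0" "v \<bullet> c = k" for v k
  proof -
    have finA: "finite A"
      using A X finite_subset by blast
    have "card {x \<in> A. k \<le> v \<bullet> x} \<le> card ({x \<in> A. 0 < v \<bullet> x - k} \<union>
        {x \<in> X. v \<bullet> x = k})"
      using A(1) X(2) finA by (intro card_mono) auto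
    also have "\<dots> \<le> card {x \<in> A. 0 < v \<bullet> x - k} + 3"
      using card_Un_le[of "{x \<in> A. 0 < v \<bullet> x - k}" "{x \<in> X. v \<bullet> x = k}"]
        general_position_plane_card[OF X v(1), of k] by linarith
    finally show ?thesis
      using c[of k v] v A by linarith
  qed
  show ?thesis
  proof (cases s)
    case True
    then show ?thesis using pos[OF u] by (simp add: on_side_def)
  next
    case False
    have "{x \<in> A. 0 < (- u) \<bullet> x - (- b)} = {x \<in> A. on_side s (u \<bullet> x - b)}"
      using False by (auto simp: on_side_def)
    then show ?thesis using pos[of "- u" "- b"] u by simp
  qed
qed

text \<open>A plane through centerpoints of \<open>A\<close>, \<open>B\<close>, \<open>C\<close> has
  many points of these three sets on both sides, so every choice of their sides is available. Some
  side also has many points of \<open>D\<close>; if it is the wrong one, the form is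
  negated.\<close>

lemma separate_four:
  fixes X :: "(real^3) set"
  assumes X: "general_position X" "finite X" and m: "3 \<le> m"
    and ABCD: "A \<subseteq> X" "B \<subseteq> X" "C \<subseteq> X" "D \<subseteq> X"
      "8 * m \<le> card A" "8 * m \<le> card B" "8 * m \<le> card C" "8 * m \<le> card D"
  obtains f where "affine_form f"
    "m \<le> card {x \<in> A. on_side s1 (f x)}" "m \<le> card {x \<in> B. on_side s2 (f x)}"
    "m \<le> card {x \<in> C. on_side s3 (f x)}" "m \<le> card {x \<in> D. on_side s4 (f x)}"
proof -
  have ex: "\<exists>c. \<forall>u b. b \<le> u \<bullet> c \<longrightarrow> card S \<le> 4 * card {x \<in> S. b \<le> u \<bullet> x}"
    if "S \<subseteq> X" "8 * m \<le> card S" for S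
  proof -
    have "finite S" "S \<noteq> {}"
      using that m X(2) finite_subset by auto
    then obtain c where "\<And>u b. b \<le> u \<bullet> c \<Longrightarrow>
        card S \<le> (DIM(real^3) + 1) * card {x \<in> S. b \<le> u \<bullet> x}"
      by (rule centerpoint_exists) blast
    then show ?thesis by (intro exI[of _ c]) simp
  qed
  obtain a where a: "\<And>u k. k \<le> u \<bullet> a \<Longrightarrow>
      card A \<le> 4 * card {x \<in> A. k \<le> u \<bullet> x}"
    using ex[OF ABCD(1,5)] by blast
  obtain b where b: "\<And>u k. k \<le> u \<bullet> b \<Longrightarrow>
      card B \<le> 4 * card {x \<in> B. k \<le> u \<bullet> x}"
    using ex[OF ABCD(2,6)] by blast
  obtain c where c: "\<And>u k. k \<le> u \<bullet> c \<Longrightarrow>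
      card C \<le> 4 * card {x \<in> C. k \<le> u \<bullet> x}"
    using ex[OF ABCD(3,7)] by blast
  \<comment> \<open>Repeating \<open>c\<close> as fourth point gives a plane through three points,
    even if they are collinear.\<close>
  obtain u k where u: "u \<noteq> 0" "u \<bullet> a = k" "u \<bullet> b = k" "u \<bullet> c = k"
    using orient_eq_0_coplanar[of a b c c] by auto
  have finD: "finite D"
    using ABCD(4) X(2) finite_subset by blast
  have D: "m \<le> card {x \<in> D. on_side s4 (u \<bullet> x - k)} \<or>
      m \<le> card {x \<in> D. on_side (\<not> s4) (u \<bullet> x - k)}"
  proof (rule ccontr)
    assume neg: "\<not> ?thesis"
    have "D \<subseteq> {x \<in> D. on_side s4 (u \<bullet> x - k)} \<union>
        {x \<in> D. on_side (\<not> s4) (u \<bullet> x - k)} \<union> {x \<in> X. u \<bullet> x = k}"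
      using ABCD(4) by (auto simp: on_side_def)
    then have "card D \<le> card ({x \<in> D. on_side s4 (u \<bullet> x - k)} \<union>
        {x \<in> D. on_side (\<not> s4) (u \<bullet> x - k)} \<union> {x \<in> X. u \<bullet> x = k})"
      using finD X(2) by (intro card_mono) auto
    also have "\<dots> \<le> card {x \<in> D. on_side s4 (u \<bullet> x - k)} +
        card {x \<in> D. on_side (\<not> s4) (u \<bullet> x - k)} + card {x \<in> X. u \<bullet> x = k}"
      by (meson add_le_mono1 card_Un_le order_trans)
    finally show False
      using neg general_position_plane_card[OF X u(1), of k] ABCD(8) m by linarith
  qed
  have sides: "m \<le> card {x \<in> A. on_side s (u \<bullet> x - k)}"
      "m \<le> card {x \<in> B. on_side s (u \<bullet> x - k)}"
    "m \<le> card {x \<in> C. on_side s (u \<bullet> x - k)}" for s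
    using centerpoint_plane_side[OF X ABCD(1,5) m a u(1,2)] centerpoint_plane_side[OF X ABCD(2,6) m b u(1,3)]
      centerpoint_plane_side[OF X ABCD(3,7) m c u(1,4)] by blast+
  from D show ?thesis
  proof
    assume "m \<le> card {x \<in> D. on_side s4 (u \<bullet> x - k)}"
    then show ?thesis
      by (rule that[OF affine_form_inner sides(1,2,3)])
  next
    assume "m \<le> card {x \<in> D. on_side (\<not> s4) (u \<bullet> x - k)}"
    then show ?thesis
      by (intro that[OF affine_form_uminus[OF affine_form_inner]]) (simp_all only: on_side_uminus sides)
  qed
qed

text \<open>A pair \<open>(U, P)\<close> in \<open>R\<close> demands a plane with the clusters of
  \<open>U\<close> in \<open>P\<close> on its positive side and the others of \<open>U\<close> on
  its negative side. The demands are met one after another, each at the cost of a factor 8 in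
  size.\<close>

lemma separate_clusters:
  fixes X :: "(real^3) set" and A :: "nat \<Rightarrow> (real^3) set"
  assumes X: "general_position X" "finite X" and m: "3 \<le> m"
    and R: "finite R" "\<And>U P. (U, P) \<in> R \<Longrightarrow> U \<subseteq> J \<and> card U = 4"
    and A: "\<And>j. j \<in> J \<Longrightarrow> A j \<subseteq> X \<and>
        8 ^ card R * m \<le> card (A j)"
  shows "\<exists>B. (\<forall>j\<in>J. B j \<subseteq> A j \<and> m \<le> card (B j)) \<and>
    (\<forall>(U, P)\<in>R. \<exists>f. affine_form f \<and>
        (\<forall>j\<in>U. \<forall>x\<in>B j. on_side (j \<in> P) (f x)))"
  using R(1) m R(2) A
proof (induction R arbitrary: m rule: finite_induct)
  case empty
  then show ?case by (intro exI[of _ A]) auto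
next
  case (insert r R)
  obtain U P where r: "r = (U, P)"
    by fastforce
  have "\<exists>B. (\<forall>j\<in>J. B j \<subseteq> A j \<and> 8 * m \<le> card (B j)) \<and>
    (\<forall>(U, P)\<in>R. \<exists>f. affine_form f \<and>
        (\<forall>j\<in>U. \<forall>x\<in>B j. on_side (j \<in> P) (f x)))"
    using insert.hyps insert.prems by (intro insert.IH) (auto simp: algebra_simps)
  then obtain B where B: "\<And>j. j \<in> J \<Longrightarrow>
      B j \<subseteq> A j \<and> 8 * m \<le> card (B j)"
    and BR': "\<forall>(U, P)\<in>R. \<exists>f. affine_form f \<and>
        (\<forall>j\<in>U. \<forall>x\<in>B j. on_side (j \<in> P) (f x))"
    by blast
  have BR: "\<exists>f. affine_form f \<and> (\<forall>j\<in>U. \<forall>x\<in>B j. on_side (j \<in> P) (f x))" if "(U, P) \<in> R" for U P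
    using bspec[OF BR' that] by simp
  have U: "U \<subseteq> J" "card U = 4"
    using insert.prems(2)[of U P] r by auto
  then have "U \<in> [J]\<^bsup>4\<^esup>"
    by (auto simp: nsets_def intro: card_ge_0_finite)
  then obtain i j k l where ijkl: "U = {i, j, k, l}" "distinct [i, j, k, l]" "{i, j, k, l} \<subseteq> J"
    unfolding nsets_4_eq by auto
  have BX: "B q \<subseteq> X \<and> 8 * m \<le> card (B q)" if "q \<in> {i, j, k, l}" for q
    using that B insert.prems(3) ijkl(3) by blast
  obtain f where f: "affine_form f"
    "m \<le> card {x \<in> B i. on_side (i \<in> P) (f x)}"
        "m \<le> card {x \<in> B j. on_side (j \<in> P) (f x)}"
    "m \<le> card {x \<in> B k. on_side (k \<in> P) (f x)}"
        "m \<le> card {x \<in> B l. on_side (l \<in> P) (f x)}"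
    by (rule separate_four[OF X insert.prems(1), of "B i" "B j" "B k" "B l" "i \<in> P" "j \<in> P"
        "k \<in> P" "l \<in> P"])
       (use BX in auto)
  define B' where "B' q = (if q \<in> U then {x \<in> B q. on_side (q \<in> P) (f x)} else B q)" for q
  have sub: "B' q \<subseteq> B q" for q
    by (auto simp: B'_def)
  have large: "m \<le> card (B' q)" if "q \<in> J" for q
    using f B[OF that] unfolding B'_def ijkl(1) by auto
  have "\<exists>g. affine_form g \<and> (\<forall>j\<in>V. \<forall>x\<in>B' j. on_side (j \<in> Q) (g x))" if VQ: "(V, Q) \<in> insert r R" for V Q
  proof (cases "(V, Q) = r")
    case True
    then have "\<forall>j\<in>V. \<forall>x\<in>B' j. on_side (j \<in> Q) (f x)"
      unfolding r by (auto simp: B'_def)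
    then show ?thesis using f(1) by blast
  next
    case False
    then obtain g where "affine_form g" "\<forall>j\<in>V. \<forall>x\<in>B j. on_side (j \<in> Q) (g x)"
      using BR VQ by blast
    then show ?thesis using sub by blast
  qed
  moreover have "\<forall>j\<in>J. B' j \<subseteq> A j \<and> m \<le> card (B' j)"
    using sub large B by blast
  ultimately show ?case
    by (intro exI[of _ B'] conjI ballI case_prodI2) simp_all
qed

section \<open>Constant orientation of separated sets\<close>

lemma affine_form_on_side_hull:
  assumes "affine_form f" "\<forall>x\<in>A. on_side s (f x)" "x \<in> convex hull A"
  shows "on_side s (f x)"
proof -
  obtain u b where f: "f = (\<lambda>x. u \<bullet> x - b)"
    using assms(1) unfolding affine_form_def by blast
  have "{x. on_side s (f x)} = (if s then {x. u \<bullet> x > b} else {x. u \<bullet> x < b})"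
    by (auto simp: on_side_def f)
  then have "convex {x. on_side s (f x)}"
    by (simp add: convex_halfspace_gt convex_halfspace_lt)
  then have "convex hull A \<subseteq> {x. on_side s (f x)}"
    using assms(2) by (intro hull_minimal) auto
  then show ?thesis
    using assms(3) by blast
qed

text \<open>If the points were coplanar, a form whose signs agree with those of the coefficients of
  an affine dependency would turn it into a positive sum equal to zero.\<close>

lemma orient_neq_0_if_separated:
  assumes sep: "\<And>s1 s2 s3 s4. \<exists>f. affine_form f \<and>
      on_side s1 (f a) \<and> on_side s2 (f b) \<and> on_side s3 (f c) \<and> on_side s4 (f d)"
  shows "orient a b c d \<noteq> 0"
proof
  assume "orient a b c d = 0"
  then obtain w x y z where 0: "w + x + y + z = 0" "\<not> (w = 0 \<and> x = 0 \<and> y =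
      0 \<and> z = 0)"
    "w *\<^sub>R a + x *\<^sub>R b + y *\<^sub>R c + z *\<^sub>R d = 0"
    by (rule orient_eq_0_dependency)
  obtain f where f: "affine_form f" "on_side (w > 0) (f a)" "on_side (x > 0) (f b)"
    "on_side (y > 0) (f c)" "on_side (z > 0) (f d)"
    using sep by blast
  obtain u k where u: "f = (\<lambda>x. u \<bullet> x - k)"
    using f(1) unfolding affine_form_def by blast
  have "w * f a + x * f b + y * f c + z * f d
      = u \<bullet> (w *\<^sub>R a + x *\<^sub>R b + y *\<^sub>R c + z *\<^sub>R d) - k * (w + x +
          y + z)"
    unfolding u by (simp add: inner_add_right algebra_simps)
  then have sum0: "w * f a + x * f b + y * f c + z * f d = 0"
    using 0 by simp
  have pos: "0 \<le> r * q \<and> (r \<noteq> 0 \<longrightarrow> 0 < r * q)"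
      if "on_side (r > 0) q" for r q :: real
    using that by (auto simp: on_side_def zero_le_mult_iff zero_less_mult_iff split: if_splits)
  show False
    using pos[OF f(2)] pos[OF f(3)] pos[OF f(4)] pos[OF f(5)] sum0 0(2) by linarith
qed

lemma sgn_orient_const_4:
  assumes "convex D" "\<And>d. d \<in> D \<Longrightarrow> orient a b c d \<noteq> 0" "d \<in> D"
      "e \<in> D"
  shows "sgn (orient a b c d) = sgn (orient a b c e)"
proof (rule ccontr)
  assume neq: "sgn (orient a b c d) \<noteq> sgn (orient a b c e)"
  define x y where xy: "x = orient a b c d" "y = orient a b c e"
  have opp: "x > 0 \<and> y < 0 \<or> x < 0 \<and> y > 0"
    using neq assms(2)[OF assms(3)] assms(2)[OF assms(4)]
    unfolding xy[symmetric] by (auto simp: sgn_if split: if_splits)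
  \<comment> \<open>The zero of the affine function with the values \<open>x\<close> at 0 and
    \<open>y\<close> at 1; it yields a coplanar quadruple on the segment from \<open>d\<close> to
    \<open>e\<close>.\<close>
  define t where "t = x / (x - y)"
  have t: "0 \<le> t" "t \<le> 1" "(1 - t) * x + t * y = 0"
    using opp by (auto simp: t_def field_simps)
  have "(1 - t) *\<^sub>R d + t *\<^sub>R e \<in> D"
    using assms(1,3,4) t by (simp add: convex_alt)
  then show False
    using assms(2) t(3) unfolding xy orient_affine4[symmetric] by blast
qed

text \<open>The points are exchanged one at a time, \<open>d\<close> first and \<open>a\<close>
  last, each after moving it to the fourth place by a permutation of known sign.\<close>

lemma sgn_orient_const:
  assumes conv: "convex A" "convex B" "convex C" "convex D"
    and nz: "\<And>a b c d. a \<in> A \<Longrightarrow> b \<in> B \<Longrightarrow> c \<in> C \<Longrightarrow>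
        d \<in> D \<Longrightarrow> orient a b c d \<noteq> 0"
    and mem: "a \<in> A" "b \<in> B" "c \<in> C" "d \<in> D" "a' \<in> A" "b' \<in> B" "c' \<in> C"
        "d' \<in> D"
  shows "sgn (orient a b c d) = sgn (orient a' b' c' d')"
proof -
  have "sgn (orient a b c d) = sgn (orient a b c d')"
    by (rule sgn_orient_const_4[OF conv(4)]) (use nz mem in auto)
  also have "\<dots> = - sgn (orient a b d' c)"
    by (simp add: orient_swap34[of a b d' c] sgn_minus)
  also have "sgn (orient a b d' c) = sgn (orient a b d' c')"
    by (rule sgn_orient_const_4[OF conv(3)]) (use nz mem in \<open>auto simp: orient_swap34[of a b d']\<close>)
  also have "- sgn (orient a b d' c') = - sgn (orient a d' c' b)"
    by (simp add: orient_swap34[of a d' b c'] orient_swap23[of a b d' c'] sgn_minus)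
  also have "sgn (orient a d' c' b) = sgn (orient a d' c' b')"
  proof (rule sgn_orient_const_4[OF conv(2) _ mem(2,6)])
    fix y assume "y \<in> B"
    then have "orient a y c' d' \<noteq> 0" using nz mem by auto
    then show "orient a d' c' y \<noteq> 0"
      using orient_swap34[of a d' y c'] orient_swap23[of a y d' c'] orient_swap34[of a y c' d'] by simp
  qed
  also have "- sgn (orient a d' c' b') = sgn (orient b' d' c' a)"
  proof -
    have "orient b' d' c' a = - orient a d' c' b'"
      by (simp add: orient_coords algebra_simps)
    then show ?thesis by (simp add: sgn_minus)
  qed
  also have "\<dots> = sgn (orient b' d' c' a')"
  proof (rule sgn_orient_const_4[OF conv(1) _ mem(1,5)])
    fix y assume "y \<in> A"
    then have "orient y b' c' d' \<noteq> 0" using nz mem by auto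
    moreover have "orient b' d' c' y = orient y b' c' d'"
      by (simp add: orient_coords algebra_simps)
    ultimately show "orient b' d' c' y \<noteq> 0" by simp
  qed
  also have "orient b' d' c' a' = orient a' b' c' d'"
    by (simp add: orient_coords algebra_simps)
  finally show ?thesis .
qed

subsection \<open>Cups and caps\<close>

definition mono_triples :: "('a \<Rightarrow> real) \<Rightarrow> ('a \<Rightarrow> 'a \<Rightarrow> 'a \<Rightarrow> bool) \<Rightarrow> 'a set \<Rightarrow> bool" where
  "mono_triples X R S \<longleftrightarrow> (\<forall>a\<in>S. \<forall>b\<in>S. \<forall>c\<in>S. X a < X b \<longrightarrow> X b < X c \<longrightarrow> R a b c)"

text \<open>The abstract property of left and right turns behind the cups-caps theorem: if both
  consecutive triples of four points turn the same way, so do the other two.\<close>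

definition transitive_triples :: "('a \<Rightarrow> real) \<Rightarrow> ('a \<Rightarrow> 'a \<Rightarrow> 'a \<Rightarrow> bool) \<Rightarrow> 'a set \<Rightarrow> bool" where
  "transitive_triples X R S \<longleftrightarrow> (\<forall>a\<in>S. \<forall>b\<in>S. \<forall>c\<in>S. \<forall>d\<in>S. X a < X b \<longrightarrow> X b < X c \<longrightarrow> X c < X d \<longrightarrow>
     R a b c \<longrightarrow> R b c d \<longrightarrow> R a b d \<and> R a c d)"

text \<open>Here \<open>e\<close> is the last and \<open>s\<close> the last but one point of
  \<open>S\<close>. The triples \<open>u s e\<close> and \<open>s e t\<close> give
  \<open>u e t\<close> for every earlier \<open>u\<close>; then \<open>a b e\<close> and
  \<open>b e t\<close> give \<open>a b t\<close>.\<close>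

lemma mono_triples_extend:
  assumes tr: "transitive_triples X R Z" and inj: "inj_on X Z"
    and S: "S \<subseteq> Z" "mono_triples X R S" "e \<in> S" "\<forall>x\<in>S. X x \<le> X e"
    and s: "s \<in> S" "s \<noteq> e" "\<forall>x\<in>S - {e}. X x \<le> X s"
    and t: "t \<in> Z" "X e < X t" "R s e t"
  shows "mono_triples X R (insert t S)"
proof -
  have lt: "X x < X e" if "x \<in> S" "x \<noteq> e" for x
    using that S inj by (metis inj_onD order_le_less subsetD)
  have last: "R u e t" if u: "u \<in> S" "u \<noteq> e" for u
  proof (cases "u = s")
    case True
    then show ?thesis using t by simp
  next
    case False
    then have us: "X u < X s"
      using u s S(1) inj by (metis Diff_iff inj_onD order_le_less singletonD subsetD)
    have "R u s e"
      using S(2,3) u s us lt unfolding mono_triples_def by blast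
    moreover have "u \<in> Z" "s \<in> Z" "e \<in> Z"
      using u s S by auto
    ultimately show ?thesis
      using tr us lt[OF s(1,2)] t unfolding transitive_triples_def by blast
  qed
  have "R a b t" if ab: "a \<in> S" "b \<in> S" "X a < X b" for a b
  proof (cases "b = e")
    case True
    then show ?thesis using last ab by blast
  next
    case False
    have "R a b e"
      using S(2,3) ab lt[OF ab(2) False] unfolding mono_triples_def by blast
    moreover have "a \<in> Z" "b \<in> Z" "e \<in> Z"
      using ab S by auto
    ultimately show ?thesis
      using tr ab(3) lt[OF ab(2) False] t last[OF ab(2) False] unfolding transitive_triples_def by blast
  qed
  moreover have "X x < X t" if "x \<in> S" for x
    using S(4) that t(2) by force
  ultimately show ?thesis
    using S(2) unfolding mono_triples_def by (metis insert_iff less_asym)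
qed

lemma mono_triples_extend_left:
  assumes tr: "transitive_triples X R Z" and inj: "inj_on X Z"
    and S: "S \<subseteq> Z" "mono_triples X R S" "e \<in> S" "\<forall>x\<in>S. X e \<le> X x"
    and s: "s \<in> S" "s \<noteq> e" "\<forall>x\<in>S - {e}. X s \<le> X x"
    and t: "t \<in> Z" "X t < X e" "R t e s"
  shows "mono_triples X R (insert t S)"
proof -
  \<comment> \<open>Reflection: negating \<open>X\<close> and reversing the triples turns the left
    end into the right end.\<close>
  have "mono_triples (\<lambda>x. - X x) (\<lambda>a b c. R c b a) (insert t S)"
  proof (rule mono_triples_extend)
    show "transitive_triples (\<lambda>x. - X x) (\<lambda>a b c. R c b a) Z"
      using tr unfolding transitive_triples_def by (simp; blast)
    show "inj_on (\<lambda>x. - X x) Z"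
      using inj by (simp add: inj_on_def)
    show "mono_triples (\<lambda>x. - X x) (\<lambda>a b c. R c b a) S"
      using S(2) unfolding mono_triples_def by auto
  qed (use S s t in auto)
  then show ?thesis
    unfolding mono_triples_def by auto
qed

lemma finite_arg_max_exists:
  fixes X :: "'a \<Rightarrow> real"
  assumes "finite S" "S \<noteq> {}"
  shows "\<exists>e\<in>S. \<forall>x\<in>S. X x \<le> X e"
proof -
  have "Max (X ` S) \<in> X ` S"
    using assms by simp
  then obtain e where "e \<in> S" "X e = Max (X ` S)"
    by auto
  then show ?thesis
    using assms(1) by (intro bexI[of _ e]) auto
qed

text \<open>Induction along Pascal's rule with the set \<open>E\<close> of right ends of
  \<open>R\<close>-chains of size \<open>a' + 2\<close>. Outside \<open>E\<close> there is no such
  chain. If \<open>E\<close> is large, it contains either the desired \<open>R\<close>-chain or an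
  opposite chain that starts where an \<open>R\<close>-chain ends, and one of these two can be
  prolonged.\<close>

lemma erdos_szekeres_cups_caps:
  assumes "finite Z" "inj_on X Z" "transitive_triples X R Z"
      "transitive_triples X (\<lambda>a b c. \<not> R a b c) Z"
    and "(a + b) choose a < card Z"
  shows "(\<exists>S\<subseteq>Z. card S = a + 2 \<and> mono_triples X R S) \<or>
         (\<exists>S\<subseteq>Z. card S = b + 2 \<and>
             mono_triples X (\<lambda>a b c. \<not> R a b c) S)"
proof -
  have pair: "mono_triples X Q S" if two: "card S = 2" for Q S
  proof -
    obtain x y where "S = {x, y}"
      using two unfolding card_2_iff by blast
    then show ?thesis
      unfolding mono_triples_def by (auto dest: less_asym)
  qed
  have sub: "transitive_triples X Q W'" if "transitive_triples X Q W" "W' \<subseteq> W" for Q W W'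
    unfolding transitive_triples_def
  proof (intro ballI)
    fix a b c d assume "a \<in> W'" "b \<in> W'" "c \<in> W'" "d \<in> W'"
    then have "a \<in> W" "b \<in> W" "c \<in> W" "d \<in> W"
      using that(2) by auto
    then show "X a < X b \<longrightarrow> X b < X c \<longrightarrow> X c < X d \<longrightarrow> Q a b c \<longrightarrow> Q b c d \<longrightarrow> Q a b d \<and> Q a c d"
      using that(1) unfolding transitive_triples_def by blast
  qed
  show ?thesis
    using assms
  proof (induction "a + b" arbitrary: a b Z rule: less_induct)
    case less
    note Z = less.prems
    consider "a = 0" | "b = 0" | a' b' where "a = Suc a'" "b = Suc b'"
      by (cases a; cases b) auto
    then show ?case
    proof cases
      \<comment> \<open>The binomial coefficient is 1, so there are two points, and a pair is
        vacuously a chain of either kind.\<close>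
      case 1
      then obtain S where "S \<subseteq> Z" "card S = 2"
        using Z(5) by (metis Suc_leI binomial_n_0 obtain_subset_with_card_n numeral_2_eq_2 One_nat_def)
      then show ?thesis using 1 pair by auto
    next
      case 2
      then obtain S where "S \<subseteq> Z" "card S = 2"
        using Z(5) by (metis Suc_leI add_0_right binomial_n_n obtain_subset_with_card_n numeral_2_eq_2 One_nat_def)
      then show ?thesis using 2 pair by auto
    next
      case (3 a' b')
      define E where "E = {e \<in> Z. \<exists>S\<subseteq>Z. card S =
          a' + 2 \<and> mono_triples X R S \<and> e \<in> S \<and> (\<forall>x\<in>S. X x \<le> X e)}"
      have EZ: "E \<subseteq> Z"
        by (auto simp: E_def)
      have pascal: "(a + b) choose a = ((a' + b) choose a') + ((a + b') choose a)"
        using 3 by (simp add: binomial_Suc_Suc)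
      have card: "card Z = card (Z - E) + card E"
        using EZ Z(1) by (metis add.commute card_mono card_Diff_subset finite_subset le_add_diff_inverse)
      show ?thesis
      proof (cases "(a' + b) choose a' < card (Z - E)")
        case True
        have "(\<exists>S\<subseteq>Z - E. card S = a' + 2 \<and> mono_triples X R S) \<or>
         (\<exists>S\<subseteq>Z - E. card S =
             b + 2 \<and> mono_triples X (\<lambda>a b c. \<not> R a b c) S)"
          using 3 Z True by (intro less.hyps) (auto intro: sub inj_on_subset)
        moreover have False if S: "S \<subseteq> Z - E" "card S = a' + 2" "mono_triples X R S" for S
        proof -
          have "finite S" "S \<noteq> {}"
            using S(2) by (auto intro: card_ge_0_finite)
          then obtain e where "e \<in> S" "\<forall>x\<in>S. X x \<le> X e"
            using finite_arg_max_exists by meson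
          then have "e \<in> E"
            using S unfolding E_def by blast
          then show False
            using S(1) \<open>e \<in> S\<close> by blast
        qed
        ultimately show ?thesis by blast
      next
        case False
        then have "(a + b') choose a < card E"
          using Z(5) pascal card by linarith
        then have "(\<exists>S\<subseteq>E. card S = a + 2 \<and> mono_triples X R S) \<or>
         (\<exists>S\<subseteq>E. card S = b' + 2 \<and>
             mono_triples X (\<lambda>a b c. \<not> R a b c) S)"
          using 3 Z EZ by (intro less.hyps) (auto intro: sub inj_on_subset finite_subset)
        then show ?thesis
        proof
          assume "\<exists>S\<subseteq>E. card S = a + 2 \<and> mono_triples X R S"
          then show ?thesis using EZ by blast
        next
          assume "\<exists>S\<subseteq>E. card S =
              b' + 2 \<and> mono_triples X (\<lambda>a b c. \<not> R a b c) S"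
          then obtain T where T: "T \<subseteq> E" "card T =
              b' + 2" "mono_triples X (\<lambda>a b c. \<not> R a b c) T"
            by blast
          have finT: "finite T" "T \<noteq> {}"
            using T(2) by (auto intro: card_ge_0_finite)
          then obtain e where e: "e \<in> T" "\<forall>x\<in>T. X e \<le> X x"
            using finite_arg_max_exists[of T "\<lambda>x. - X x"] by auto
          have "card (T - {e}) = b' + 1"
            using T(2) e(1) finT by simp
          then have "T - {e} \<noteq> {}"
            by (metis add_is_0 card.empty one_neq_zero)
          then obtain t where t: "t \<in> T" "t \<noteq> e" "\<forall>x\<in>T - {e}. X t \<le> X x"
            using finite_arg_max_exists[of "T - {e}" "\<lambda>x. - X x"] finT by auto
          \<comment> \<open>Both chains meet in \<open>e\<close>, the right end of \<open>S\<close>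
            and the left end of \<open>T\<close>. The triple of \<open>e\<close> and its neighbours
            \<open>s\<close> in \<open>S\<close> and \<open>t\<close> in \<open>T\<close> decides
            which of them grows.\<close>
          obtain S where S: "S \<subseteq> Z" "card S =
              a' + 2" "mono_triples X R S" "e \<in> S" "\<forall>x\<in>S. X x \<le> X e"
            using e(1) T(1) unfolding E_def by blast
          have finS: "finite S"
            using S(2) by (auto intro: card_ge_0_finite)
          have "card (S - {e}) = a' + 1"
            using S(2,4) finS by simp
          then have "S - {e} \<noteq> {}"
            by (metis add_is_0 card.empty one_neq_zero)
          then obtain s where s: "s \<in> S" "s \<noteq> e" "\<forall>x\<in>S - {e}. X x \<le> X s"
            using finite_arg_max_exists[of "S - {e}" X] finS by auto
          have TZ: "T \<subseteq> Z" using T(1) EZ by blast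
          have et: "X e < X t"
            using e t TZ Z(2) by (metis inj_onD order_le_less subsetD)
          have se: "X s < X e"
            using S s Z(2) by (metis inj_onD order_le_less subsetD)
          show ?thesis
          proof (cases "R s e t")
            case True
            have "mono_triples X R (insert t S)"
              using S s t(1) TZ et True by (intro mono_triples_extend[OF Z(3,2)]) auto
            moreover have "t \<notin> S"
              using S(5) et by force
            ultimately show ?thesis
              using S finS t(1) TZ 3 by (intro disjI1 exI[of _ "insert t S"]) auto
          next
            case False
            have "mono_triples X (\<lambda>a b c. \<not> R a b c) (insert s T)"
              using S s t e T TZ se False by (intro mono_triples_extend_left[OF Z(4,2)]) auto
            moreover have "s \<notin> T"
              using e(2) se by force
            ultimately show ?thesis
              using T finT s(1) S(1) TZ 3 by (intro disjI2 exI[of _ "insert s T"]) auto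
          qed
        qed
      qed
    qed
  qed
qed

text \<open>Colouring triples by the sign of \<open>turn\<close>, positive when the slope decreases,
  gives caps and cups. At a point of a cap the slopes to the left exceed those to the right, and any
  slope in between gives a strictly supporting line; cups are reflected caps.\<close>

lemma cups_caps_supporting_lines:
  fixes X Y :: "'a \<Rightarrow> real"
  assumes fin: "finite Z" and inj: "inj_on X Z"
    and no_collinear: "\<And>x y z. x \<in> Z \<Longrightarrow> y \<in> Z \<Longrightarrow>
        z \<in> Z \<Longrightarrow> X x < X y \<Longrightarrow> X y < X z \<Longrightarrow>
      (Y y - Y x) * (X z - X y) \<noteq> (Y z - Y y) * (X y - X x)"
    and card: "(a + b) choose a < card Z"
  shows "(\<exists>S\<subseteq>Z. card S = a + 2 \<and> (\<forall>y\<in>S. \<exists>k c. Y y =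
      k * X y + c \<and> (\<forall>x\<in>S - {y}. Y x < k * X x + c))) \<or>
         (\<exists>S\<subseteq>Z. card S = b + 2 \<and> (\<forall>y\<in>S. \<exists>k c. Y y =
             k * X y + c \<and> (\<forall>x\<in>S - {y}. Y x > k * X x + c)))"
proof -
  define turn where "turn x y z = (Y y - Y x) * (X z - X y) - (Y z - Y y) * (X y - X x)" for x y z
  have turn_nz: "turn x y z \<noteq> 0" if "x \<in> Z" "y \<in> Z" "z \<in> Z" "X x < X y"
      "X y < X z" for x y z
    using no_collinear[OF that] by (simp add: turn_def)
  \<comment> \<open>These identities write the turns of the two non-consecutive triples as positive
    combinations of the consecutive ones, whence transitivity.\<close>
  have id1: "turn x y w * (X z - X y) = turn x y z * (X w - X y) + turn y z w * (X y - X x)"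
    and id2: "turn x z w * (X z - X y) = turn x y z * (X w - X z) + turn y z w * (X z - X x)" for x y z w
    unfolding turn_def by (simp_all add: algebra_simps)
  have trans: "transitive_triples X (\<lambda>x y z. s * turn x y z > 0) Z" for s
    unfolding transitive_triples_def
  proof (intro ballI impI)
    fix x y z w
    assume lt: "X x < X y" "X y < X z" "X z < X w" and pos: "0 < s * turn x y z" "0 < s * turn y z w"
    have "0 < (s * turn x y z) * (X w - X y) + (s * turn y z w) * (X y - X x)"
      by (intro add_pos_pos mult_pos_pos pos) (use lt in auto)
    also have "\<dots> = s * (turn x y z * (X w - X y) + turn y z w * (X y - X x))"
      by (simp only: distrib_left mult.assoc)
    also have "\<dots> = (s * turn x y w) * (X z - X y)"
      by (simp only: id1[of x y w z, symmetric] mult.assoc)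
    finally have 1: "0 < s * turn x y w"
      by (rule zero_less_mult_pos2) (use lt in simp)
    have "0 < (s * turn x y z) * (X w - X z) + (s * turn y z w) * (X z - X x)"
      by (intro add_pos_pos mult_pos_pos pos) (use lt in auto)
    also have "\<dots> = s * (turn x y z * (X w - X z) + turn y z w * (X z - X x))"
      by (simp only: distrib_left mult.assoc)
    also have "\<dots> = (s * turn x z w) * (X z - X y)"
      by (simp only: id2[of x z w y, symmetric] mult.assoc)
    finally have "0 < s * turn x z w"
      by (rule zero_less_mult_pos2) (use lt in simp)
    with 1 show "0 < s * turn x y w \<and> 0 < s * turn x z w" by blast
  qed
  have tr1: "transitive_triples X (\<lambda>x y z. turn x y z > 0) Z"
    using trans[of 1] by simp
  have tr2: "transitive_triples X (\<lambda>x y z. \<not> turn x y z > 0) Z"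
    unfolding transitive_triples_def
  proof (intro ballI impI)
    fix x y z w
    assume mem: "x \<in> Z" "y \<in> Z" "z \<in> Z" "w \<in> Z"
        and lt: "X x < X y" "X y < X z" "X z < X w"
      and neg: "\<not> turn x y z > 0" "\<not> turn y z w > 0"
    have "- 1 * turn x y z > 0" "- 1 * turn y z w > 0"
      using neg turn_nz[of x y z] turn_nz[of y z w] mem lt by auto
    then have "- 1 * turn x y w > 0 \<and> - 1 * turn x z w > 0"
      using trans[of "-1"] mem lt unfolding transitive_triples_def by blast
    then show "\<not> turn x y w > 0 \<and> \<not> turn x z w > 0"
      by auto
  qed
  have support: "\<exists>k c. Y y = k * X y + c \<and>
      (\<forall>x\<in>S - {y}. 0 < s * (k * X x + c - Y x))"
    if S: "S \<subseteq> Z" "y \<in> S" and s: "s = 1 \<or> s = -1"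
      and mono: "\<forall>x\<in>S. \<forall>y\<in>S. \<forall>z\<in>S. X x < X y \<longrightarrow> X y < X z \<longrightarrow> s * turn x y z > 0" for S y s
  proof -
    \<comment> \<open>Slopes seen from \<open>y\<close>; the factor \<open>s\<close> is 1 for caps
      and -1 for cups, so that one argument serves both.\<close>
    define sl where "sl x = s * ((Y x - Y y) / (X x - X y))" for x
    define L where "L = sl ` {x \<in> S. X x < X y}"
    define Rt where "Rt = sl ` {x \<in> S. X y < X x}"
    have finLR: "finite L" "finite Rt"
      using finite_subset[OF S(1) fin] unfolding L_def Rt_def by auto
    have less: "r < l" if lr: "l \<in> L" "r \<in> Rt" for l r
    proof -
      obtain x z where xz: "x \<in> S" "z \<in> S" "X x < X y" "X y < X z" "l = sl x" "r = sl z"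
        using lr unfolding L_def Rt_def by blast
      have "s * turn x y z > 0"
        using mono xz S(2) by blast
      then have "s * ((Y z - Y y) * (X y - X x)) < s * ((Y y - Y x) * (X z - X y))"
        unfolding turn_def by (simp add: algebra_simps)
      then have "s * (Y z - Y y) / (X z - X y) < s * (Y y - Y x) / (X y - X x)"
        using xz by (simp add: field_simps)
      moreover have "(Y y - Y x) / (X y - X x) = (Y x - Y y) / (X x - X y)"
        by (metis minus_diff_eq minus_divide_divide)
      ultimately show ?thesis
        unfolding xz(5,6) sl_def by (metis times_divide_eq_right)
    qed
    have "\<exists>k. (\<forall>l\<in>L. k < l) \<and> (\<forall>r\<in>Rt. r < k)"
    proof (cases "L = {}")
      case True
      obtain M where "\<And>r. r \<in> Rt \<Longrightarrow> r \<le> M"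
        using bdd_above_finite[OF finLR(2)] unfolding bdd_above_def by blast
      then show ?thesis
        using True by (intro exI[of _ "M + 1"]) force
    next
      case Lne: False
      show ?thesis
      proof (cases "Rt = {}")
        case True
        obtain M where "\<And>l. l \<in> L \<Longrightarrow> M \<le> l"
          using bdd_below_finite[OF finLR(1)] unfolding bdd_below_def by blast
        then show ?thesis
          using True by (intro exI[of _ "M - 1"]) force
      next
        case False
        have "Max Rt < Min L"
          using less finLR Lne False by simp
        then obtain k where "Max Rt < k" "k < Min L"
          using dense by blast
        then show ?thesis
          using finLR Lne False by (intro exI[of _ k]) simp
      qed
    qed
    then obtain k where k: "\<And>l. l \<in> L \<Longrightarrow> k < l" "\<And>r. r \<in> Rt \<Longrightarrow>
        r < k"
      by blast
    have ss: "s * s = 1"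
      using s by auto
    have "0 < s * ((s * k) * X x + (Y y - (s * k) * X y) - Y x)" if x: "x \<in> S - {y}" for x
    proof -
      have "X x \<noteq> X y"
        using x S inj by (metis Diff_iff inj_onD singletonI subsetD)
      then consider "X x < X y" | "X y < X x" by linarith
      then have "s * (Y x - Y y) < k * (X x - X y)"
      proof cases
        case 1
        then have "k < sl x" using k(1) x unfolding L_def by blast
        then show ?thesis using 1 by (simp add: sl_def field_simps)
      next
        case 2
        then have "sl x < k" using k(2) x unfolding Rt_def by blast
        then show ?thesis using 2 by (simp add: sl_def field_simps)
      qed
      moreover have "s * ((s * k) * X x + (Y y - (s * k) * X y) - Y x) =
          (s * s) * k * (X x - X y) - s * (Y x - Y y)"
        by (simp add: algebra_simps)
      ultimately show ?thesis
        unfolding ss by simp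
    qed
    then show ?thesis
      by (intro exI[of _ "s * k"] exI[of _ "Y y - (s * k) * X y"]) auto
  qed
  from erdos_szekeres_cups_caps[OF fin inj tr1 tr2 card] show ?thesis
  proof
    assume "\<exists>S\<subseteq>Z. card S =
        a + 2 \<and> mono_triples X (\<lambda>x y z. turn x y z > 0) S"
    then obtain S where S: "S \<subseteq> Z" "card S =
        a + 2" "mono_triples X (\<lambda>x y z. turn x y z > 0) S"
      by blast
    then show ?thesis
      using support[of S _ 1] by (intro disjI1 exI[of _ S]) (auto simp: mono_triples_def)
  next
    assume "\<exists>S\<subseteq>Z. card S =
        b + 2 \<and> mono_triples X (\<lambda>x y z. \<not> turn x y z > 0) S"
    then obtain S where S: "S \<subseteq> Z" "card S =
        b + 2" "mono_triples X (\<lambda>x y z. \<not> turn x y z > 0) S"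
      by blast
    have "\<forall>x\<in>S. \<forall>y\<in>S. \<forall>z\<in>S. X x < X y \<longrightarrow> X y < X z \<longrightarrow> - 1 * turn x y z > 0"
    proof (intro ballI impI)
      fix x y z assume "x \<in> S" "y \<in> S" "z \<in> S" "X x < X y" "X y < X z"
      then show "- 1 * turn x y z > 0"
        using S(1,3) turn_nz[of x y z] unfolding mono_triples_def by force
    qed
    then have "\<exists>k c. Y y = k * X y + c \<and> (\<forall>x\<in>S - {y}. Y x > k * X x + c)"
        if "y \<in> S" for y
      using support[OF S(1) that, of "-1"] by simp
    then show ?thesis
      using S by (intro disjI2 exI[of _ S]) auto
  qed
qed

subsection \<open>Caps seen from one cluster\<close>

lemma convex_position_if_supported:
  assumes "finite Y" and sup: "\<And>y. y \<in> Y \<Longrightarrow>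
      \<exists>f. affine_form f \<and> f y = 0 \<and> (\<forall>x\<in>Y - {y}. f x < 0)"
  shows "convex_position Y"
  unfolding convex_position_iff
proof (intro conjI ballI notI)
  show "finite Y" by fact
  fix y assume y: "y \<in> Y" "y \<in> convex hull (Y - {y})"
  obtain f where f: "affine_form f" "f y = 0" "\<forall>x\<in>Y - {y}. f x < 0"
    using sup[OF y(1)] by blast
  have "on_side False (f y)"
    by (rule affine_form_on_side_hull[OF f(1) _ y(2)]) (use f(3) in \<open>simp add: on_side_def\<close>)
  then show False
    using f(2) by (simp add: on_side_def)
qed

lemma convex_position_subset:
  fixes Y :: "'a::euclidean_space set"
  assumes "convex_position Y" "Y' \<subseteq> Y"
  shows "convex_position Y'"
  unfolding convex_position_iff
proof (intro conjI ballI)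
  show "finite Y'"
    using assms finite_subset unfolding convex_position_iff by blast
  fix x assume x: "x \<in> Y'"
  have "convex hull (Y' - {x}) \<subseteq> convex hull (Y - {x})"
    using assms(2) by (intro hull_mono) blast
  then show "x \<notin> convex hull (Y' - {x})"
    using assms x unfolding convex_position_iff by blast
qed

lemma orient_move_2_to_4: "orient a c d b = orient a b c d"
  and orient_move_1_to_4: "orient b c d a = - orient a b c d"
  by (simp_all add: orient_coords algebra_simps)

section \<open>Planes through a moving point of the middle cluster\<close>

text \<open>The extremal plane of the early side: \<open>q 3\<close> is the moving point, and
  \<open>q 0\<close>, \<open>q 2\<close> are the two candidates for the second early point. Since
  the value at \<open>q 1\<close> is -1, the value at \<open>q 5\<close> is minus the ratio to be
  controlled.\<close>

lemma left_form_exists: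
  assumes "cyclic_points \<sigma> q 7"
  obtains f where "affine_form f" "f (q 0) = 0" "f (q 2) = 0" "f (q 3) = 0" "f (q 1) = -1"
proof -
  have nz: "orient (q 0) (q 2) (q 3) (q 1) \<noteq> 0"
    unfolding orient_move_2_to_4[of "q 0" "q 2" "q 3"
        "q 1"] using cyclic_pointsD[OF assms, of 0 1 2 3] by auto
  show ?thesis
    by (rule that[OF affine_form_scale[OF affine_form_orient, of
        "-1 / orient (q 0) (q 2) (q 3) (q 1)" "q 0" "q 2" "q 3"]])
      (use nz in simp_all)
qed

text \<open>The extremal plane of the late side, with candidates \<open>q 4\<close> and
  \<open>q 6\<close>. It is normalised at \<open>q 1\<close> as well, so that both ratios are
  comparable.\<close>

lemma right_form_exists:
  assumes "cyclic_points \<sigma> q 7"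
  obtains f where "affine_form f" "f (q 3) = 0" "f (q 4) = 0" "f (q 6) = 0" "f (q 1) = -1"
proof -
  have nz: "orient (q 3) (q 4) (q 6) (q 1) \<noteq> 0"
    unfolding orient_move_1_to_4[of "q 3" "q 4" "q 6"
        "q 1"] using cyclic_pointsD[OF assms, of 1 3 4 6] by auto
  show ?thesis
    by (rule that[OF affine_form_scale[OF affine_form_orient, of
        "-1 / orient (q 3) (q 4) (q 6) (q 1)" "q 3" "q 4" "q 6"]])
      (use nz in simp_all)
qed

text \<open>A nonnegative value at \<open>q 4\<close> or \<open>q 6\<close> would complete a weak
  alternation along \<open>q 0\<close>, \<open>q 1\<close>, \<open>q 2\<close>, \<open>q 3\<close>
  and force the value -1 at \<open>q 1\<close> to be zero.\<close>

lemma left_form_signs: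
  assumes q: "cyclic_points \<sigma> q 7"
      and f: "affine_form f" "f (q 0) = 0" "f (q 2) = 0" "f (q 3) = 0" "f (q 1) = -1"
  shows "f (q 4) < 0" "f (q 6) < 0"
proof -
  show "f (q 4) < 0"
    using cyclic_points_alternation[OF q f(1), of 0 1 2 3 4] f by force
  show "f (q 6) < 0"
    using cyclic_points_alternation[OF q f(1), of 0 1 2 3 6] f by force
qed

lemma right_form_signs:
  assumes q: "cyclic_points \<sigma> q 7"
      and f: "affine_form f" "f (q 3) = 0" "f (q 4) = 0" "f (q 6) = 0" "f (q 1) = -1"
  shows "f (q 5) < 0" "f (q 0) < 0" "f (q 2) < 0"
proof -
  show 5: "f (q 5) < 0"
    using cyclic_points_alternation[OF q affine_form_uminus[OF f(1)], of 1 3 4 5 6] f by force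
  show "f (q 0) < 0"
    using cyclic_points_alternation[OF q f(1), of 0 1 4 5 6] f 5 by force
  show "f (q 2) < 0"
    using cyclic_points_alternation[OF q f(1), of 2 3 4 5 6] f 5 by force
qed

text \<open>A form vanishing at the moving point is pinned down on the line through \<open>q 1\<close> and \<open>q 5\<close> by
  the ratio \<open>f (q 5) / f (q 1)\<close>. Large ratios allow a form that is negative neither at \<open>q 0\<close> nor at
  \<open>q 2\<close>, small ones a form that is negative neither at \<open>q 4\<close> nor at \<open>q 6\<close>; the two ranges are
  disjoint even for different moving points, because the difference of the two extremal forms would
  alternate in sign five times.\<close>

lemma right_ratio_less_left_ratio:
  assumes q: "cyclic_points \<sigma> q 7" and q': "cyclic_points \<sigma> q' 7"
    and eq: "\<And>i. i \<noteq> 3 \<Longrightarrow> q' i = q i"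
    and f: "affine_form f" "f (q 0) = 0" "f (q 2) = 0" "f (q 3) = 0" "f (q 1) = -1"
    and g: "affine_form g" "g (q' 3) = 0" "g (q 4) = 0" "g (q 6) = 0" "g (q 1) = -1"
  shows "f (q 5) < g (q 5)"
proof (rule ccontr)
  assume "\<not> ?thesis"
  moreover have "g (q 0) < 0" "g (q 2) < 0"
    using right_form_signs[OF q' g(1)] g by (simp_all add: eq)
  \<comment> \<open>At the indices 0, 1, 2, 4, 5 the difference \<open>f - g\<close> is positive,
    zero, positive, negative, nonnegative. Index 3, the only place where \<open>q\<close> and
    \<open>q'\<close> may differ, is avoided.\<close>
  ultimately show False
    using cyclic_points_alternation[OF q affine_form_diff[OF f(1) g(1)], of 0 1 2 4 5]
      left_form_signs[OF q f] f g by force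
qed

text \<open>All ratios of right extremal forms lie below all ratios of left ones, so one ratio
  between them suits every \<open>z\<close> at once. The open interval is infinite, which leaves
  room to avoid the finite set \<open>V\<close> of degenerate ratios.\<close>

lemma balanced_ratio_exists:
  assumes Z: "finite Z" "Z \<noteq> {}" and cyc: "\<And>z. z \<in> Z \<Longrightarrow>
      cyclic_points \<sigma> (p(3 := z)) 7"
    and V: "finite V"
  obtains \<rho> where "\<rho> > 0" "\<rho> \<notin> V"
    "\<And>z f. z \<in> Z \<Longrightarrow> affine_form f \<Longrightarrow> f z = 0 \<Longrightarrow>
        f (p 1) = -1 \<Longrightarrow> f (p 5) = - \<rho> \<Longrightarrow>
      (f (p 0) < 0 \<or> f (p 2) < 0) \<and> (f (p 4) < 0 \<or> f (p 6) < 0)"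
proof -
  have "\<exists>f. affine_form f \<and> f (p 0) = 0 \<and> f (p 2) = 0 \<and> f z =
      0 \<and> f (p 1) = -1" if "z \<in> Z" for z
    using left_form_exists[OF cyc[OF that]] by fastforce
  then obtain F where F: "\<And>z. z \<in> Z \<Longrightarrow>
      affine_form (F z)" "\<And>z. z \<in> Z \<Longrightarrow> F z (p 0) = 0"
    "\<And>z. z \<in> Z \<Longrightarrow> F z (p 2) = 0" "\<And>z. z \<in> Z \<Longrightarrow>
        F z z = 0" "\<And>z. z \<in> Z \<Longrightarrow> F z (p 1) = -1"
    by metis
  have "\<exists>f. affine_form f \<and> f z = 0 \<and> f (p 4) = 0 \<and> f (p 6) =
      0 \<and> f (p 1) = -1" if "z \<in> Z" for z
    using right_form_exists[OF cyc[OF that]] by fastforce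
  then obtain G where G: "\<And>z. z \<in> Z \<Longrightarrow>
      affine_form (G z)" "\<And>z. z \<in> Z \<Longrightarrow> G z z = 0"
    "\<And>z. z \<in> Z \<Longrightarrow> G z (p 4) = 0" "\<And>z. z \<in> Z \<Longrightarrow>
        G z (p 6) = 0" "\<And>z. z \<in> Z \<Longrightarrow> G z (p 1) = -1"
    by metis
  have less: "F z (p 5) < G w (p 5)" if zw: "z \<in> Z" "w \<in> Z" for z w
    using right_ratio_less_left_ratio[OF cyc[OF zw(1)] cyc[OF zw(2)], of "F z"
        "G w"] F[OF zw(1)] G[OF zw(2)]
    by simp
  have Gneg: "G w (p 5) < 0" if w: "w \<in> Z" for w
    using right_form_signs(1)[OF cyc[OF w], of "G w"] G[OF w] by simp
  define lo where "lo = Max ((\<lambda>z. - G z (p 5)) ` Z)"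
  define hi where "hi = Min ((\<lambda>z. - F z (p 5)) ` Z)"
  have "lo < hi"
    unfolding lo_def hi_def using Z less by simp
  then have "infinite {lo<..<hi}"
    by simp
  then have "infinite ({lo<..<hi} - V)"
    using V by (rule Diff_infinite_finite[rotated])
  then obtain \<rho> where \<rho>: "lo < \<rho>" "\<rho> < hi" "\<rho> \<notin> V"
    by (metis Diff_iff finite.emptyI equals0I greaterThanLessThan_iff)
  have lo: "- G z (p 5) < \<rho>" if "z \<in> Z" for z
    using \<rho>(1) Z that unfolding lo_def by simp
  have hi: "\<rho> < - F z (p 5)" if "z \<in> Z" for z
    using \<rho>(2) Z that unfolding hi_def by simp
  obtain z0 where "z0 \<in> Z" using Z by blast
  then have "\<rho> > 0"
    using lo Gneg by force
  moreover have "(f (p 0) < 0 \<or> f (p 2) < 0) \<and> (f (p 4) < 0 \<or> f (p 6) < 0)"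
    if z: "z \<in> Z" and f: "affine_form f" "f z = 0" "f (p 1) = -1" "f (p 5) = - \<rho>" for z f
  proof (intro conjI; rule ccontr)
    \<comment> \<open>At the indices 0, 1, 2, 3, 5 the difference \<open>f - F z\<close> would be
      nonnegative, zero, nonnegative, zero, positive.\<close>
    assume "\<not> (f (p 0) < 0 \<or> f (p 2) < 0)"
    then show False
      using cyclic_points_alternation[OF cyc[OF z] affine_form_diff[OF f(1) F(1)[OF z]], of 0 1 2 3 5]
        f F[OF z] hi[OF z] by simp
  next
    \<comment> \<open>At the indices 1, 3, 4, 5, 6 the difference \<open>f - G z\<close> would be
      zero, zero, nonnegative, negative, nonnegative.\<close>
    assume "\<not> (f (p 4) < 0 \<or> f (p 6) < 0)"
    then show False
      using cyclic_points_alternation[OF cyc[OF z] affine_form_diff[OF f(1) G(1)[OF z]], of 1 3 4 5 6]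
        f G[OF z] lo[OF z] by simp
  qed
  ultimately show ?thesis
    using that \<rho>(3) by blast
qed

text \<open>Negative values mean "below"; no vertical direction is fixed, since the centre of
  projection varies from cluster to cluster.\<close>

definition cap_over :: "(real^3) set \<Rightarrow> real^3 \<Rightarrow> real^3 \<Rightarrow> real^3 \<Rightarrow> real^3 \<Rightarrow> bool" where
  "cap_over Y a b c d \<longleftrightarrow> (\<forall>y\<in>Y. \<exists>f. affine_form f \<and> f y =
      0 \<and> (\<forall>x\<in>Y - {y}. f x < 0) \<and>
     f a < 0 \<and> f b < 0 \<and> f c < 0 \<and> f d < 0)"

text \<open>\<open>Z\<close> is projected from the point, possibly at infinity, where the forms with
  values -1 at \<open>p 1\<close> and \<open>- \<rho>\<close> at \<open>p 5\<close> vanish on the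
  line through these points. Lines of the projection plane lift to such forms, so a planar cap gets
  supporting planes with \<open>p 1\<close> and \<open>p 5\<close> below, and the balanced ratio
  puts one more early and one more late point below each. A planar cup gives convex position
  outright.\<close>

lemma cap_over_exists:
  fixes X :: "(real^3) set"
  assumes X: "general_position X" "finite X" and Z: "Z \<subseteq> X" and p: "p 1 \<in> X" "p 5 \<in> X"
    and cyc: "\<And>z. z \<in> Z \<Longrightarrow> cyclic_points \<sigma> (p(3 := z)) 7"
    and card: "(4 * m + n) choose (4 * m) < card Z"
  shows "(\<exists>Y\<subseteq>Z. card Y = n \<and> convex_position Y) \<or>
    (\<exists>Y\<subseteq>Z. card Y = m \<and> (\<exists>(a, b)\<in>{(0, 1), (1, 2)}. \<exists>(c, d)\<in>{(4, 5), (5, 6)}.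
       cap_over Y (p a) (p b) (p c) (p d)))"
proof -
  note One_nat_def[simp del]
  have fin: "finite Z" and ne: "Z \<noteq> {}"
    using Z X(2) finite_subset card by auto
  obtain z0 where z0: "z0 \<in> Z" using ne by blast
  have o: "\<sigma> * orient (p 1) (p 2) z (p 5) > 0" "\<sigma> * orient (p 1) (p 2) (p 4) (p 5) > 0"
    "\<sigma> * orient (p 1) z (p 4) (p 5) > 0" if "z \<in> Z" for z
    using cyclic_pointsD[OF cyc[OF that], of 1 2 3 5] cyclic_pointsD[OF cyc[OF that], of 1 2 4 5]
      cyclic_pointsD[OF cyc[OF that], of 1 3 4 5] by simp_all
  have nz: "orient (p 1) (p 2) (p 4) (p 5) \<noteq> 0"
    using o(2)[OF z0] by auto
  have dist: "p 1 \<noteq> p 5" "z \<noteq> p 1" "z \<noteq> p 5" if "z \<in> Z" for z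
    using o(1)[OF that] by auto
  \<comment> \<open>The ratios at \<open>p 5\<close> and \<open>p 1\<close> of planes through three
    points of \<open>Z\<close>; avoiding them keeps the projected points free of collinear
    triples.\<close>
  define V where "V = (\<lambda>(x, y, z). orient x y z (p 5) / orient x y z (p 1)) ` (Z \<times> Z \<times> Z)"
  have "finite V"
    unfolding V_def using fin by auto
  then obtain \<rho> where \<rho>: "\<rho> > 0" "\<rho> \<notin> V" and balanced:
    "\<And>z f. z \<in> Z \<Longrightarrow> affine_form f \<Longrightarrow> f z = 0 \<Longrightarrow>
        f (p 1) = -1 \<Longrightarrow> f (p 5) = - \<rho> \<Longrightarrow>
      (f (p 0) < 0 \<or> f (p 2) < 0) \<and> (f (p 4) < 0 \<or> f (p 6) < 0)"
    using balanced_ratio_exists[where p = p and Z = Z, OF fin ne cyc, of V] by metis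
  \<comment> \<open>Homogeneous coordinates of the projection: \<open>\<xi>0\<close> and
    \<open>\<xi>1\<close> vanish on the line through \<open>p 1\<close> and \<open>p 5\<close>, and
    \<open>\<xi>2\<close> has the values -1 and \<open>- \<rho>\<close> there. The sign of
    \<open>\<xi>0\<close> makes it positive on \<open>Z\<close>, so dividing by it preserves
    sides.\<close>
  define \<xi>0 where "\<xi>0 x = (- \<sigma>) * orient (p 1) (p 2) (p 5) x" for x
  define \<xi>1 where "\<xi>1 x = orient (p 1) (p 4) (p 5) x" for x
  define \<xi>2 where "\<xi>2 x = (1 / orient (p 1) (p 2) (p 4) (p 5)) * orient (p 2) (p 4) (p 5) x
    - (\<rho> / orient (p 1) (p 2) (p 4) (p 5)) * orient (p 1) (p 2) (p 4) x" for x
  have aff: "affine_form \<xi>0" "affine_form \<xi>1" "affine_form \<xi>2"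
    unfolding \<xi>0_def \<xi>1_def \<xi>2_def
    by (intro affine_form_diff affine_form_scale affine_form_orient)+
  have at1: "\<xi>0 (p 1) = 0" "\<xi>1 (p 1) = 0" "\<xi>2 (p 1) = -1"
    unfolding \<xi>0_def \<xi>1_def \<xi>2_def orient_move_1_to_4[of "p 2" "p 4" "p 5"
        "p 1"] using nz by simp_all
  have at5: "\<xi>0 (p 5) = 0" "\<xi>1 (p 5) = 0" "\<xi>2 (p 5) = - \<rho>"
    unfolding \<xi>0_def \<xi>1_def \<xi>2_def using nz by simp_all
  have \<xi>0_pos: "\<xi>0 z > 0" if "z \<in> Z" for z
    using o(1)[OF that] unfolding \<xi>0_def orient_swap34[of "p 1" "p 2" z "p 5"] by simp
  define line where "line k c x = \<xi>2 x - k * \<xi>1 x - c * \<xi>0 x" for k c x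
  have line: "affine_form (line k c)" "line k c (p 1) = -1" "line k c (p 5) = - \<rho>" for k c
    unfolding line_def by (intro affine_form_diff affine_form_scale aff) (simp_all add: at1 at5)
  define U W where "U z = \<xi>1 z / \<xi>0 z" and "W z = \<xi>2 z / \<xi>0 z" for z
  have line_eq: "line k c z = \<xi>0 z * (W z - (k * U z + c))" if "z \<in> Z" for k c z
    using \<xi>0_pos[OF that] unfolding line_def U_def W_def by (simp add: field_simps)
  have inj: "inj_on U Z"
  proof (rule inj_onI, rule ccontr)
    fix z w assume zw: "z \<in> Z" "w \<in> Z" "U z = U w" "z \<noteq> w"
    \<comment> \<open>Equal abscissas would put \<open>z\<close> and \<open>w\<close> on a common
      plane with \<open>p 1\<close> and \<open>p 5\<close>, against general position.\<close>
    define f where "f x = \<xi>1 x - U z * \<xi>0 x" for x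
    have "affine_form f"
      unfolding f_def by (intro affine_form_diff affine_form_scale aff)
    moreover have "f (p 1) = 0" "f (p 5) = 0"
      by (simp_all add: f_def at1 at5)
    moreover have "f z = 0" "f w = 0"
      using \<xi>0_pos[OF zw(1)] \<xi>0_pos[OF zw(2)] zw(3) by (auto simp: f_def U_def field_simps)
    moreover have "f (p 2) \<noteq> 0"
      unfolding f_def \<xi>0_def \<xi>1_def orient_move_2_to_4[of "p 1" "p 4" "p 5" "p 2"] using nz
          by simp
    ultimately have "orient (p 1) (p 5) z w = 0"
      using affine_form_Cramer[of f "p 5" z w "p 2" "p 1"] by simp
    moreover have "orient (p 1) (p 5) z w \<noteq> 0"
      using X(1) p Z zw dist by (intro general_position_orient[of X]) auto
    ultimately show False by blast
  qed
  have no_collinear: "(W y - W x) * (U z - U y) \<noteq> (W z - W y) * (U y - U x)"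
    if xyz: "x \<in> Z" "y \<in> Z" "z \<in> Z" "U x < U y" "U y < U z" for x y z
  proof
    assume eq: "(W y - W x) * (U z - U y) = (W z - W y) * (U y - U x)"
    define k where "k = (W y - W x) / (U y - U x)"
    define c where "c = W x - k * U x"
    have "k * (U y - U x) = W y - W x"
      using xyz by (simp add: k_def)
    moreover have "k * (U z - U y) = W z - W y"
      using eq xyz unfolding k_def by (simp add: field_simps)
    ultimately have "W x = k * U x + c" "W y = k * U y + c" "W z = k * U z + c"
      unfolding c_def right_diff_distrib by linarith+
    then have "line k c x = 0" "line k c y = 0" "line k c z = 0"
      unfolding line_eq[OF xyz(1)] line_eq[OF xyz(2)] line_eq[OF xyz(3)] by simp_all
    \<comment> \<open>Three zeros remove all but two terms of the five-point dependency of
      \<open>x\<close>, \<open>y\<close>, \<open>z\<close>, \<open>p 1\<close>,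
      \<open>p 5\<close>.\<close>
    then have "orient x y z (p 5) = \<rho> * orient x y z (p 1)"
      using affine_form_Cramer[OF line(1)[of k c], of y z "p 1" "p 5" x] line[of k c] by simp
    moreover have "orient x y z (p 1) \<noteq> 0"
      using X(1) p Z xyz dist by (intro general_position_orient[of X]) auto
    ultimately have "\<rho> \<in> V"
      unfolding V_def using xyz by (intro image_eqI[of _ _ "(x, y, z)"]) auto
    then show False using \<rho>(2) by blast
  qed
  from cups_caps_supporting_lines[OF fin inj no_collinear card] show ?thesis
  proof
    assume "\<exists>S\<subseteq>Z. card S = 4 * m + 2 \<and>
      (\<forall>y\<in>S. \<exists>k c. W y =
          k * U y + c \<and> (\<forall>x\<in>S - {y}. W x < k * U x + c))"
    then obtain S where S: "S \<subseteq> Z" "card S = 4 * m + 2"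
      "\<And>y. y \<in> S \<Longrightarrow> \<exists>k c. W y =
          k * U y + c \<and> (\<forall>x\<in>S - {y}. W x < k * U x + c)"
      by blast
    have "\<exists>f. affine_form f \<and> f y =
        0 \<and> (\<forall>x\<in>S - {y}. f x < 0) \<and> f (p 1) < 0 \<and> f (p 5) < 0 \<and>
      (f (p 0) < 0 \<or> f (p 2) < 0) \<and> (f (p 4) < 0 \<or> f (p 6) < 0)" if y: "y \<in> S" for y
    proof -
      obtain k c where kc: "W y = k * U y + c" "\<forall>x\<in>S - {y}. W x < k * U x + c"
        using S(3)[OF y] by blast
      have yZ: "y \<in> Z" using S(1) y by blast
      have "line k c y = 0"
        using line_eq[OF yZ] kc(1) by simp
      moreover have "line k c x < 0" if x: "x \<in> S - {y}" for x
      proof -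
        have "x \<in> Z" "W x - (k * U x + c) < 0"
          using x S(1) kc(2) by auto
        then show ?thesis
          unfolding line_eq[OF \<open>x \<in> Z\<close>] by (intro mult_pos_neg \<xi>0_pos)
      qed
      ultimately show ?thesis
        using line[of k c] balanced[OF yZ line(1)[of k c]] \<rho>(1) by (intro exI[of _ "line k c"]) auto
    qed
    then obtain F where F: "\<And>y. y \<in> S \<Longrightarrow>
        affine_form (F y)" "\<And>y. y \<in> S \<Longrightarrow> F y y = 0"
      "\<And>y x. y \<in> S \<Longrightarrow> x \<in> S - {y} \<Longrightarrow> F y x < 0"
      "\<And>y. y \<in> S \<Longrightarrow> F y (p 1) < 0 \<and> F y (p 5) < 0 \<and>
      (F y (p 0) < 0 \<or> F y (p 2) < 0) \<and> (F y (p 4) < 0 \<or> F y (p 6) < 0)"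
      by metis
    have finS: "finite S" using S(1) fin finite_subset by blast
    have cap: "\<exists>Y\<subseteq>Z. card Y = m \<and> cap_over Y a b c d"
      if T: "m \<le> card {y \<in> S. F y a < 0 \<and> F y b < 0 \<and> F y c < 0 \<and>
          F y d < 0}" for a b c d
    proof -
      obtain Y where Y: "Y \<subseteq> {y \<in> S. F y a < 0 \<and> F y b < 0 \<and> F y c < 0 \<and>
          F y d < 0}" "card Y = m"
        using T by (rule obtain_subset_with_card_n)
      have "cap_over Y a b c d"
        unfolding cap_over_def
      proof (intro ballI)
        fix y assume "y \<in> Y"
        then show "\<exists>f. affine_form f \<and> f y =
            0 \<and> (\<forall>x\<in>Y - {y}. f x < 0) \<and> f a < 0 \<and> f b < 0 \<and> f c < 0 \<and> f d < 0"
          using Y(1) F(1,2)[of y] F(3)[of y] by (intro exI[of _ "F y"]) blast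
      qed
      then show ?thesis using Y S(1) by blast
    qed
    let ?T = "\<lambda>a b c d. {y \<in> S. F y (p a) < 0 \<and> F y (p b) < 0 \<and> F y (p c) < 0 \<and>
        F y (p d) < 0}"
    \<comment> \<open>Each supporting plane chooses one of two early and one of two late candidates:
      four classes for \<open>4 * m + 2\<close> points, so some class has at least
      \<open>m\<close>.\<close>
    have "S \<subseteq> ?T 0 1 4 5 \<union> ?T 0 1 5 6 \<union> (?T 1 2 4 5 \<union> ?T 1 2 5 6)"
      using F(4) by blast
    then have "card S \<le> card (?T 0 1 4 5 \<union> ?T 0 1 5 6 \<union> (?T 1 2 4 5 \<union>
        ?T 1 2 5 6))"
      using finS by (intro card_mono) auto
    also have "\<dots> \<le> card (?T 0 1 4 5) + card (?T 0 1 5 6) + (card (?T 1 2 4 5) +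
        card (?T 1 2 5 6))"
      by (intro order.trans[OF card_Un_le] add_mono card_Un_le)
    finally consider "m \<le> card (?T 0 1 4 5)" | "m \<le> card (?T 0 1 5 6)" |
        "m \<le> card (?T 1 2 4 5)" | "m \<le> card (?T 1 2 5 6)"
      using S(2) by linarith
    then show ?thesis
    proof cases
      case 1
      from cap[OF this] show ?thesis by (intro disjI2) auto
    next
      case 2
      from cap[OF this] show ?thesis by (intro disjI2) auto
    next
      case 3
      from cap[OF this] show ?thesis by (intro disjI2) auto
    next
      case 4
      from cap[OF this] show ?thesis by (intro disjI2) auto
    qed
  next
    assume "\<exists>S\<subseteq>Z. card S = n + 2 \<and>
      (\<forall>y\<in>S. \<exists>k c. W y =
          k * U y + c \<and> (\<forall>x\<in>S - {y}. W x > k * U x + c))"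
    then obtain S where S: "S \<subseteq> Z" "card S = n + 2"
      "\<And>y. y \<in> S \<Longrightarrow> \<exists>k c. W y =
          k * U y + c \<and> (\<forall>x\<in>S - {y}. W x > k * U x + c)"
      by blast
    have "convex_position S"
    proof (rule convex_position_if_supported)
      show "finite S" using S(1) fin finite_subset by blast
      fix y assume y: "y \<in> S"
      obtain k c where kc: "W y = k * U y + c" "\<forall>x\<in>S - {y}. W x > k * U x + c"
        using S(3)[OF y] by blast
      have yZ: "y \<in> Z" using S(1) y by blast
      have "- line k c y = 0"
        using line_eq[OF yZ] kc(1) by simp
      moreover have "- line k c x < 0" if x: "x \<in> S - {y}" for x
      proof -
        have "x \<in> Z" "W x - (k * U x + c) > 0"
          using x S(1) kc(2) by auto
        then show ?thesis
          unfolding line_eq[OF \<open>x \<in> Z\<close>] using \<xi>0_pos by simp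
      qed
      ultimately show "\<exists>f. affine_form f \<and> f y = 0 \<and> (\<forall>x\<in>S - {y}. f x < 0)"
        using affine_form_uminus[OF line(1)[of k c]] by blast
    qed
    moreover obtain Y where Y: "Y \<subseteq> S" "card Y = n"
      by (rule obtain_subset_with_card_n[of n S]) (simp add: S(2))
    ultimately have "convex_position Y"
      using convex_position_subset by blast
    then show ?thesis
      using Y S(1) by (intro disjI1 exI[of _ Y]) auto
  qed
qed

subsection \<open>Cyclic clusters and Ramsey arguments\<close>

definition cyclic_clusters :: "real \<Rightarrow> (nat \<Rightarrow> (real^3) set) \<Rightarrow> nat \<Rightarrow> bool" where
  "cyclic_clusters \<sigma> A N \<longleftrightarrow> (\<forall>i j k l. i < j \<longrightarrow> j < k \<longrightarrow> k < l \<longrightarrow> l < N \<longrightarrow>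
     (\<forall>a\<in>A i. \<forall>b\<in>A j. \<forall>c\<in>A k. \<forall>d\<in>A l. \<sigma> * orient a b c d > 0))"

lemma cyclic_clustersD:
  "cyclic_clusters \<sigma> A N \<Longrightarrow> i < j \<Longrightarrow> j < k \<Longrightarrow>
      k < l \<Longrightarrow> l < N \<Longrightarrow>
     a \<in> A i \<Longrightarrow> b \<in> A j \<Longrightarrow> c \<in> A k \<Longrightarrow>
         d \<in> A l \<Longrightarrow> \<sigma> * orient a b c d > 0"
  unfolding cyclic_clusters_def by blast

lemma cyclic_clusters_points:
  assumes "cyclic_clusters \<sigma> A N" "\<And>i. i < N \<Longrightarrow> p i \<in> A i"
  shows "cyclic_points \<sigma> p N"
  unfolding cyclic_points_def using assms by (auto intro!: cyclic_clustersD[OF assms(1)])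

lemma cyclic_clusters_nth:
  assumes "cyclic_clusters \<sigma> A N" "strict_sorted xs" "set xs \<subseteq> {..<N}"
  shows "cyclic_clusters \<sigma> (\<lambda>j. A (xs ! j)) (length xs)"
  unfolding cyclic_clusters_def
proof (intro allI impI ballI)
  fix i j k l a b c d
  assume lt: "i < j" "j < k" "k < l" "l < length xs"
    and mem: "a \<in> A (xs ! i)" "b \<in> A (xs ! j)" "c \<in> A (xs ! k)" "d \<in> A (xs ! l)"
  have "xs ! i < xs ! j" "xs ! j < xs ! k" "xs ! k < xs ! l" "xs ! l < N"
    using sorted_wrt_nth_less[OF assms(2)] lt assms(3) nth_mem by fastforce+
  then show "\<sigma> * orient a b c d > 0"
    using cyclic_clustersD[OF assms(1)] mem by blast
qed

text \<open>The signs are opposite to those of \<open>no_five_alternations\<close>, as suits planes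
  with the two extreme points below.\<close>

lemma cyclic_clusters_alternation:
  assumes cl: "cyclic_clusters \<sigma> A N" and f: "affine_form f"
    and lt: "i < j" "j < k" "k < l" "l < q" "q < N"
    and mem: "a \<in> A i" "b \<in> A j" "c \<in> A k" "d \<in> A l" "e \<in> A q"
    and sgn: "f a \<le> 0" "f b \<ge> 0" "f c \<le> 0" "f d \<ge> 0" "f e \<le> 0"
  shows "f a = 0 \<and> f b = 0 \<and> f c = 0 \<and> f d = 0 \<and> f e = 0"
proof -
  have lt': "i < k" "i < l" "j < l" "j < q" "k < q" "l < N"
    using lt by linarith+
  note D = cyclic_clustersD[OF cl]
  have "- f a = 0 \<and> - f b = 0 \<and> - f c = 0 \<and> - f d = 0 \<and> - f e = 0"
    by (rule no_five_alternations[OF affine_form_uminus[OF f]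
        D[OF lt(2,3,4,5) mem(2,3,4,5)] D[OF lt'(1) lt(3,4,5) mem(1,3,4,5)] D[OF lt(1) lt'(3) lt(4,5) mem(1,2,4,5)]
        D[OF lt(1,2) lt'(5) lt(5) mem(1,2,3,5)] D[OF lt(1,2,3) lt'(6) mem(1,2,3,4)]]) (use sgn in auto)
  then show ?thesis by simp
qed

text \<open>Realising every sign pattern on every four of \<open>N\<close> clusters makes the
  orientation nonzero, hence of constant sign, on each quadruple of hulls. Ramsey's theorem for the
  colouring of quadruples by this sign leaves \<open>K\<close> clusters with a common sign. The
  constant depends on \<open>K\<close> only, since \<open>N\<close> and \<open>R\<close> do.\<close>

lemma cyclic_clusters_exist:
  "\<exists>C>0. \<forall>(X :: (real^3) set) L. general_position X \<longrightarrow> finite X \<longrightarrow> 3 \<le> L \<longrightarrow> C * L \<le> card X \<longrightarrow>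
     (\<exists>A \<sigma>. cyclic_clusters \<sigma> A K \<and> (\<forall>i<K. A i \<subseteq> X \<and>
         L \<le> card (A i)))"
proof -
  obtain N :: nat where N: "partn_lst {..<N} [K, K] 4"
    using ramsey_full by blast
  define R where "R = {(U, P). U \<subseteq> {..<N} \<and> card U = 4 \<and> P \<subseteq> U}"
  have "R \<subseteq> Pow {..<N} \<times> Pow {..<N}"
    unfolding R_def by auto
  then have finR: "finite R"
    by (rule finite_subset) auto
  have "\<exists>A \<sigma>. cyclic_clusters \<sigma> A K \<and> (\<forall>i<K. A i \<subseteq> X \<and>
      L \<le> card (A i))"
    if X: "general_position X" "finite X" "3 \<le> L" "8 ^ card R * L \<le> card X"
        for X :: "(real^3) set" and L
  proof -
    txt \<open>All clusters start out as \<open>X\<close> itself; the separation makes them disjoint.\<close>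
    have "\<exists>B. (\<forall>j\<in>{..<N}. B j \<subseteq> X \<and> L \<le> card (B j)) \<and>
      (\<forall>(U, P)\<in>R. \<exists>f. affine_form f \<and>
          (\<forall>j\<in>U. \<forall>x\<in>B j. on_side (j \<in> P) (f x)))"
      using separate_clusters[OF X(1,2,3) finR, of "{..<N}" "\<lambda>_. X"] X(4) unfolding R_def by auto
    then obtain B where B': "\<forall>j\<in>{..<N}. B j \<subseteq> X \<and> L \<le> card (B j)"
      and BR: "\<forall>(U, P)\<in>R. \<exists>f. affine_form f \<and>
          (\<forall>j\<in>U. \<forall>x\<in>B j. on_side (j \<in> P) (f x))"
      by blast
    have B: "B j \<subseteq> X \<and> L \<le> card (B j)" if "j < N" for j
      using B' that by simp
    have "\<exists>x. x \<in> B j" if "j < N" for j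
      using B[OF that] X(3) by (metis card.empty ex_in_conv not_numeral_le_zero order_trans)
    then obtain r where r: "\<And>j. j < N \<Longrightarrow> r j \<in> B j"
      by metis
    have sgn_const: "sgn (orient a b c d) =
        sgn (orient (r i) (r j) (r k) (r l)) \<and> orient a b c d \<noteq> 0"
      if lt: "i < j" "j < k" "k < l" "l < N"
          and mem: "a \<in> B i" "b \<in> B j" "c \<in> B k" "d \<in> B l" for i j k l a b c d
    proof -
      have nz: "orient x y z w \<noteq> 0"
        if hull: "x \<in> convex hull B i" "y \<in> convex hull B j" "z \<in> convex hull B k"
            "w \<in> convex hull B l" for x y z w
      proof (rule orient_neq_0_if_separated)
        fix s1 s2 s3 s4
        \<comment> \<open>The indices that the prescribed pattern puts on the positive side.\<close>
        define P where "P = {q. q = i \<and> s1 \<or> q = j \<and> s2 \<or> q = k \<and> s3 \<or> q =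
            l \<and> s4}"
        have "({i, j, k, l}, P) \<in> R"
          using lt unfolding R_def P_def by auto
        from bspec[OF BR this] have "\<exists>f. affine_form f \<and>
            (\<forall>q\<in>{i, j, k, l}. \<forall>x\<in>B q. on_side (q \<in> P) (f x))"
          by (simp only: split_conv)
        then obtain f where f: "affine_form f"
            "\<forall>q\<in>{i, j, k, l}. \<forall>x\<in>B q. on_side (q \<in> P) (f x)"
          by blast
        have "i \<in> P \<longleftrightarrow> s1" "j \<in> P \<longleftrightarrow> s2" "k \<in> P \<longleftrightarrow>
            s3" "l \<in> P \<longleftrightarrow> s4"
          using lt unfolding P_def by auto
        then have "on_side s1 (f x) \<and> on_side s2 (f y) \<and> on_side s3 (f z) \<and>
            on_side s4 (f w)"
          using affine_form_on_side_hull[OF f(1) _ hull(1)] affine_form_on_side_hull[OF f(1) _ hull(2)]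
            affine_form_on_side_hull[OF f(1) _ hull(3)] affine_form_on_side_hull[OF f(1) _ hull(4)] f(2) by simp
        then show "\<exists>f. affine_form f \<and> on_side s1 (f x) \<and> on_side s2 (f y) \<and>
            on_side s3 (f z) \<and> on_side s4 (f w)"
          using f(1) by blast
      qed
      have "sgn (orient a b c d) = sgn (orient (r i) (r j) (r k) (r l))"
        by (rule sgn_orient_const[OF convex_convex_hull convex_convex_hull convex_convex_hull convex_convex_hull nz])
          (use mem r lt in \<open>auto intro: hull_inc\<close>)
      then show ?thesis
        using nz[OF hull_inc[OF mem(1)] hull_inc[OF mem(2)] hull_inc[OF mem(3)] hull_inc[OF mem(4)]] by blast
    qed
    define col where "col U = (let xs = sorted_list_of_set U in
      if orient (r (xs ! 0)) (r (xs ! 1)) (r (xs ! 2)) (r (xs ! 3)) > 0 then 0 else 1::nat)" for U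
    have col: "col {i, j, k, l} = (if orient (r i) (r j) (r k) (r l) > 0 then 0 else 1)"
      if lt: "i < j" "j < k" "k < l" for i j k l
    proof -
      have "sorted_list_of_set (set [i, j, k, l]) = [i, j, k, l]"
        by (rule sorted_list_of_set.idem_if_sorted_distinct) (use lt in auto)
      then show ?thesis
        unfolding col_def by (simp add: Let_def numeral_2_eq_2 numeral_3_eq_3)
    qed
    have "col \<in> [{..<N}]\<^bsup>4\<^esup> \<rightarrow> {..<2}"
      by (auto simp: col_def Let_def)
    then obtain s H where s: "s < length [K, K]"
      and H: "H \<in> [{..<N}]\<^bsup>([K, K] ! s)\<^esup>" "col ` [H]\<^bsup>4\<^esup> \<subseteq> {s}"
      by (rule partn_lstE[OF N]) simp
    have HK: "H \<subseteq> {..<N}" "finite H" "card H = K"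
      using s H(1) by (auto simp: nsets_def less_Suc_eq)
    define xs where "xs = sorted_list_of_set H"
    have xs: "strict_sorted xs" "set xs = H" "length xs = K"
      using HK unfolding xs_def by auto
    \<comment> \<open>Colour 1 only says that the representatives are not positively oriented; as
      orientations across clusters are nonzero, it means negative.\<close>
    define \<sigma> :: real where "\<sigma> = (if s = 0 then 1 else -1)"
    have "\<sigma> * orient a b c d > 0"
      if lt: "i < j" "j < k" "k < l" "l < K"
        and mem: "a \<in> B (xs ! i)" "b \<in> B (xs ! j)" "c \<in> B (xs ! k)"
            "d \<in> B (xs ! l)" for i j k l a b c d
    proof -
      have lt': "xs ! i < xs ! j" "xs ! j < xs ! k" "xs ! k < xs ! l"
        using sorted_wrt_nth_less[OF xs(1)] lt xs(3) by auto
      have in_H: "xs ! i \<in> H" "xs ! j \<in> H" "xs ! k \<in> H" "xs ! l \<in> H"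
        using lt xs nth_mem by (metis order.strict_trans)+
      then have "{xs ! i, xs ! j, xs ! k, xs ! l} \<in> [H]\<^bsup>4\<^esup>"
        using lt' by (auto simp: nsets_def)
      then have "col {xs ! i, xs ! j, xs ! k, xs ! l} = s"
        using H(2) by blast
      then have "s = (if orient (r (xs ! i)) (r (xs ! j)) (r (xs ! k)) (r (xs ! l)) > 0 then 0 else 1)"
        using col[OF lt'] by simp
      moreover have "sgn (orient a b c d) =
          sgn (orient (r (xs ! i)) (r (xs ! j)) (r (xs ! k)) (r (xs ! l))) \<and> orient a b c d \<noteq> 0"
        using sgn_const[OF lt' _ mem] in_H(4) HK(1) by blast
      ultimately show ?thesis
        unfolding \<sigma>_def by (auto simp: sgn_if split: if_splits)
    qed
    then have "cyclic_clusters \<sigma> (\<lambda>j. B (xs ! j)) K"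
      unfolding cyclic_clusters_def by blast
    moreover have "\<forall>i<K. B (xs ! i) \<subseteq> X \<and> L \<le> card (B (xs ! i))"
      using B HK(1) xs nth_mem by (metis lessThan_iff subsetD)
    ultimately show ?thesis by blast
  qed
  then show ?thesis
    by (intro exI[of _ "8 ^ card R"]) auto
qed

text \<open>Clusters 0 and \<open>3 * t + 1\<close> are outer guards; the cap in cluster
  \<open>3 * q + 2\<close> has its own guards in the two neighbouring clusters. A point of another
  cap on or above a supporting plane at \<open>y\<close> would lie between an outer and an inner
  guard and, with \<open>y\<close> and the other inner guard, complete a forbidden
  alternation.\<close>

lemma convex_position_Union_caps:
  assumes cl: "cyclic_clusters \<sigma> A (3 * t + 2)" and r: "\<And>i. i < 3 * t + 2 \<Longrightarrow>
      r i \<in> A i"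
    and Y: "\<And>q. q < t \<Longrightarrow> Y q \<subseteq> A (3 * q + 2)" "\<And>q. q < t \<Longrightarrow>
        finite (Y q)" "\<And>q. q < t \<Longrightarrow> card (Y q) = m"
    and cap: "\<And>q. q < t \<Longrightarrow> cap_over (Y q) (r 0) (r (3 * q + 1)) (r (3 * q +
        3)) (r (3 * t + 1))"
  shows "convex_position (\<Union>q<t. Y q)" "card (\<Union>q<t. Y q) = t * m"
proof -
  have sup: "\<exists>f. affine_form f \<and> f y = 0 \<and> (\<forall>x\<in>Y q - {y}. f x < 0) \<and>
      (\<forall>q'<t. q' \<noteq> q \<longrightarrow> (\<forall>x\<in>Y q'. f x < 0))"
          if q: "q < t" and y: "y \<in> Y q" for q y
  proof -
    obtain f where f: "affine_form f" "f y = 0" "\<forall>x\<in>Y q - {y}. f x < 0"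
      "f (r 0) < 0" "f (r (3 * q + 1)) < 0" "f (r (3 * q + 3)) < 0" "f (r (3 * t + 1)) < 0"
      using cap[OF q] y unfolding cap_over_def by blast
    have yA: "y \<in> A (3 * q + 2)"
      using Y(1)[OF q] y by blast
    have "f x < 0" if q': "q' < t" "q' \<noteq> q" and x: "x \<in> Y q'" for q' x
    proof (rule ccontr)
      assume neg: "\<not> f x < 0"
      have xA: "x \<in> A (3 * q' + 2)"
        using Y(1)[OF q'(1)] x by blast
      consider "q' < q" | "q < q'"
        using q'(2) by linarith
      then show False
      proof cases
        case 1
        have "f (r 0) = 0 \<and> f x = 0 \<and> f (r (3 * q + 1)) = 0 \<and> f y =
            0 \<and> f (r (3 * q + 3)) = 0"
          by (rule cyclic_clusters_alternation[OF cl f(1), of 0 "3 * q' + 2" "3 * q + 1" "3 * q +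
              2" "3 * q + 3"])
            (use 1 q r xA yA f neg in auto)
        then show False using f(4) by simp
      next
        case 2
        have "f (r (3 * q + 1)) = 0 \<and> f y = 0 \<and> f (r (3 * q + 3)) = 0 \<and> f x =
            0 \<and> f (r (3 * t + 1)) = 0"
          by (rule cyclic_clusters_alternation[OF cl f(1), of "3 * q + 1" "3 * q + 2" "3 * q +
              3" "3 * q' + 2" "3 * t + 1"])
            (use 2 q q' r xA yA f neg in auto)
        then show False using f(5) by simp
      qed
    qed
    then show ?thesis
      using f(1-3) by blast
  qed
  have fin: "finite (\<Union>q<t. Y q)"
    using Y(2) by auto
  show "convex_position (\<Union>q<t. Y q)"
  proof (rule convex_position_if_supported[OF fin])
    fix y assume "y \<in> (\<Union>q<t. Y q)"
    then obtain q where q: "q < t" "y \<in> Y q" by auto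
    obtain f where f: "affine_form f" "f y = 0" "\<forall>x\<in>Y q - {y}. f x < 0"
      "\<forall>q'<t. q' \<noteq> q \<longrightarrow> (\<forall>x\<in>Y q'. f x < 0)"
      using sup[OF q] by blast
    have "f x < 0" if x: "x \<in> (\<Union>q<t. Y q) - {y}" for x
    proof -
      obtain q' where "q' < t" "x \<in> Y q'" "x \<noteq> y" using x by auto
      then show ?thesis using f(3,4) by (cases "q' = q") auto
    qed
    then show "\<exists>f. affine_form f \<and> f y =
        0 \<and> (\<forall>x\<in>(\<Union>q<t. Y q) - {y}. f x < 0)"
      using f(1,2) by blast
  qed
  \<comment> \<open>At a common point the supporting form would be both zero and negative.\<close>
  have disj: "Y q \<inter> Y q' = {}" if qq: "q < t" "q' < t" "q \<noteq> q'" for q q'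
  proof (rule ccontr)
    assume "Y q \<inter> Y q' \<noteq> {}"
    then obtain y where y: "y \<in> Y q" "y \<in> Y q'" by blast
    obtain f :: "real^3 \<Rightarrow> real" where "f y =
        0" "\<forall>q'<t. q' \<noteq> q \<longrightarrow> (\<forall>x\<in>Y q'. f x < 0)"
      using sup[OF qq(1) y(1)] by blast
    then show False
      using qq y(2) by force
  qed
  have "card (\<Union>q<t. Y q) = (\<Sum>q<t. card (Y q))"
    by (rule card_UN_disjoint) (use Y(2) disj in auto)
  also have "\<dots> = t * m"
    using Y(3) by simp
  finally show "card (\<Union>q<t. Y q) = t * m" .
qed

lemma cap_over_five_tuple_exists:
  fixes X :: "(real^3) set"
  assumes X: "general_position X" "finite X" and cl: "cyclic_clusters \<sigma> A 7"
    and A: "\<And>i. i < 7 \<Longrightarrow> A i \<subseteq> X" and r: "\<And>i. i < 7 \<Longrightarrow>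
        r i \<in> A i"
    and card: "(4 * m + n) choose (4 * m) < card (A 3)"
    and no_convex: "\<not> (\<exists>Y\<subseteq>X. card Y = n \<and> convex_position Y)"
  shows "\<exists>a b c d. a < b \<and> b < 3 \<and> 3 < c \<and> c < d \<and> d < 7 \<and>
    (\<exists>Y\<subseteq>A 3. card Y = m \<and> cap_over Y (r a) (r b) (r c) (r d))"
proof -
  have "(\<exists>Y\<subseteq>A 3. card Y = n \<and> convex_position Y) \<or>
    (\<exists>Y\<subseteq>A 3. card Y = m \<and>
        (\<exists>(a, b)\<in>{(0, 1), (1, 2)}. \<exists>(c, d)\<in>{(4, 5), (5, 6)}.
       cap_over Y (r a) (r b) (r c) (r d)))"
  proof (rule cap_over_exists[OF X A _ _ _ card, where \<sigma> = \<sigma>])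
    show "r 1 \<in> X" "r 5 \<in> X"
      using A[of 1] r[of 1] A[of 5] r[of 5] by auto
    fix z assume z: "z \<in> A 3"
    show "cyclic_points \<sigma> (r(3 := z)) 7"
      by (rule cyclic_clusters_points[OF cl]) (use r z in auto)
  qed simp
  then obtain Y a b c d where Y: "Y \<subseteq> A 3" "card Y = m" "cap_over Y (r a) (r b) (r c) (r d)"
    and ab: "(a, b) \<in> {(0, 1), (1, 2)}" and cd: "(c, d) \<in> {(4, 5), (5, 6)}"
    using no_convex A[of 3] by fastforce
  have "a < b" "b < 3" "3 < c" "c < d" "d < 7"
    using ab cd by auto
  then show ?thesis
    using Y by blast
qed

text \<open>A 5-tuple of clusters is \<open>good\<close> if the middle one has a cap over the
  representatives of the others. Seven clusters with only bad 5-tuples contradict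
  \<open>cap_over_five_tuple_exists\<close>, so Ramsey's theorem gives \<open>3 * t + 2\<close>
  clusters with only good ones, whose caps are united.\<close>

lemma convex_subset_of_cyclic_clusters:
  fixes X :: "(real^3) set"
  assumes X: "general_position X" "finite X" and N: "partn_lst {..<N} [3 * t + 2, 7] 5"
    and cl: "cyclic_clusters \<sigma> A N"
    and A: "\<And>i. i < N \<Longrightarrow> A i \<subseteq> X" "\<And>i. i < N \<Longrightarrow>
        (4 * m + n) choose (4 * m) < card (A i)"
    and n: "n \<le> t * m"
  shows "\<exists>Y\<subseteq>X. card Y = n \<and> convex_position Y"
proof (rule ccontr)
  assume no_convex: "\<not> ?thesis"
  have "\<exists>x. x \<in> A i" if "i < N" for i
    using A(2)[OF that] by (metis card.empty ex_in_conv not_less_zero)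
  then obtain r where r: "\<And>i. i < N \<Longrightarrow> r i \<in> A i"
    by metis
  define good where "good a b i c d \<longleftrightarrow> (\<exists>Y\<subseteq>A i. card Y =
      m \<and> cap_over Y (r a) (r b) (r c) (r d))" for a b i c d
  define col where "col U = (let xs = sorted_list_of_set U in
    if good (xs ! 0) (xs ! 1) (xs ! 2) (xs ! 3) (xs ! 4) then 0 else 1::nat)" for U
  have col: "col {a, b, i, c, d} = (if good a b i c d then 0 else 1)"
    if lt: "a < b" "b < i" "i < c" "c < d" for a b i c d
  proof -
    have "sorted_list_of_set (set [a, b, i, c, d]) = [a, b, i, c, d]"
      by (rule sorted_list_of_set.idem_if_sorted_distinct) (use lt in auto)
    then show ?thesis
      unfolding col_def by (simp add: Let_def eval_nat_numeral)
  qed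
  have "col \<in> [{..<N}]\<^bsup>5\<^esup> \<rightarrow> {..<2}"
    by (auto simp: col_def Let_def)
  then obtain s H where s: "s < length [3 * t + 2, 7]"
    and H: "H \<in> [{..<N}]\<^bsup>([3 * t +
        2, 7] ! s)\<^esup>" "col ` [H]\<^bsup>5\<^esup> \<subseteq> {s}"
    by (rule partn_lstE[OF N]) simp
  define xs where "xs = sorted_list_of_set H"
  have fin: "finite H" and HN: "H \<subseteq> {..<N}"
    using H(1) by (auto simp: nsets_def)
  have xs: "strict_sorted xs" "set xs = H"
    using fin unfolding xs_def by auto
  have len: "length xs = [3 * t + 2, 7] ! s"
    using H(1) unfolding xs_def nsets_def by simp
  have xsN: "xs ! i < N" if "i < length xs" for i
    using that HN xs(2) nth_mem by blast
  define B where "B i = A (xs ! i)" for i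
  have clB: "cyclic_clusters \<sigma> B (length xs)"
    unfolding B_def by (rule cyclic_clusters_nth[OF cl xs(1)]) (simp add: xs(2) HN)
  have rB: "r (xs ! i) \<in> B i" and BX: "B i \<subseteq> X"
      and cardB: "(4 * m + n) choose (4 * m) < card (B i)"
    if "i < length xs" for i
    using r A xsN[OF that] unfolding B_def by auto
  have col_xs: "s = (if good (xs ! a) (xs ! b) (xs ! i) (xs ! c) (xs ! d) then 0 else 1)"
    if lt: "a < b" "b < i" "i < c" "c < d" "d < length xs" for a b i c d
  proof -
    have lt': "xs ! a < xs ! b" "xs ! b < xs ! i" "xs ! i < xs ! c" "xs ! c < xs ! d"
      using sorted_wrt_nth_less[OF xs(1)] lt by auto
    have "{xs ! a, xs ! b, xs ! i, xs ! c, xs ! d} \<subseteq> H"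
      unfolding xs(2)[symmetric] using lt by auto
    then have "{xs ! a, xs ! b, xs ! i, xs ! c, xs ! d} \<in> [H]\<^bsup>5\<^esup>"
      using lt' by (auto simp: nsets_def)
    then have "col {xs ! a, xs ! b, xs ! i, xs ! c, xs ! d} = s"
      using H(2) by blast
    then show ?thesis
      using col[OF lt'] by simp
  qed
  show False
  proof (cases "s = 0")
    case False
    then have s7: "s = 1" "length xs = 7"
      using s len by auto
    have "\<exists>a b c d. a < b \<and> b < 3 \<and> 3 < c \<and> c < d \<and> d < 7 \<and>
      (\<exists>Y\<subseteq>B 3. card Y = m \<and>
          cap_over Y (r (xs ! a)) (r (xs ! b)) (r (xs ! c)) (r (xs ! d)))"
      by (rule cap_over_five_tuple_exists[OF X, where r = "\<lambda>i. r (xs ! i)"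
          and \<sigma> = \<sigma> and n = n])
        (use clB BX rB cardB s7(2) no_convex in auto)
    then obtain a b c d where "a < b" "b < 3" "3 < c" "c < d" "d < 7"
        "good (xs ! a) (xs ! b) (xs ! 3) (xs ! c) (xs ! d)"
      unfolding good_def B_def by blast
    then show False
      using col_xs[of a b 3 c d] s7 by simp
  next
    case True
    then have lenM: "length xs = 3 * t + 2"
      using len by simp
    have "good (xs ! 0) (xs ! (3 * q + 1)) (xs ! (3 * q + 2)) (xs ! (3 * q + 3)) (xs ! (3 * t +
        1))" if q: "q < t" for q
      using col_xs[of 0 "3 * q + 1" "3 * q + 2" "3 * q + 3" "3 * t +
          1"] q True lenM by (auto split: if_splits)
    then have "\<exists>Y\<subseteq>B (3 * q + 2). card Y = m \<and>
      cap_over Y (r (xs ! 0)) (r (xs ! (3 * q + 1))) (r (xs ! (3 * q + 3))) (r (xs ! (3 * t + 1)))"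
          if "q < t" for q
      using that unfolding good_def B_def by blast
    then obtain Y where Y: "\<And>q. q < t \<Longrightarrow>
        Y q \<subseteq> B (3 * q + 2)" "\<And>q. q < t \<Longrightarrow> card (Y q) = m"
      "\<And>q. q < t \<Longrightarrow> cap_over (Y q) (r (xs ! 0)) (r (xs ! (3 * q +
          1))) (r (xs ! (3 * q + 3))) (r (xs ! (3 * t + 1)))"
      by metis
    have YX: "Y q \<subseteq> X" if "q < t" for q
      using Y(1)[OF that] BX[of "3 * q + 2"] that lenM by auto
    have "convex_position (\<Union>q<t. Y q) \<and> card (\<Union>q<t. Y q) = t * m"
      using convex_position_Union_caps[of \<sigma> B t "\<lambda>i. r (xs ! i)" Y m] clB lenM rB Y
        finite_subset[OF YX X(2)] by simp
    moreover obtain Y' where Y': "Y' \<subseteq> (\<Union>q<t. Y q)" "card Y' = n"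
      by (rule obtain_subset_with_card_n[of n "\<Union>q<t. Y q"]) (use calculation n in auto)
    ultimately have "convex_position Y'"
      using convex_position_subset by blast
    moreover have "Y' \<subseteq> X"
      using Y'(1) YX by blast
    ultimately show False
      using no_convex Y'(2) by blast
  qed
qed

subsection \<open>Asymptotics\<close>

lemma binomial_mult_power_le:
  fixes x :: real
  assumes "0 \<le> x"
  shows "real (N choose k) * x ^ k \<le> (1 + x) ^ N"
proof (cases "k \<le> N")
  case True
  have "real (N choose k) * x ^ k \<le> (\<Sum>i\<le>N. real (N choose i) * x ^ i)"
    using True assms by (intro member_le_sum[of k "{..N}" "\<lambda>i. real (N choose i) * x ^ i"]) auto
  also have "\<dots> = (x + 1) ^ N"
    by (simp add: binomial_ring)
  finally show ?thesis
    by (simp add: add.commute)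
next
  case False
  then show ?thesis
    using assms by (simp add: binomial_eq_0)
qed

lemma power_eventually_ge:
  fixes b :: real
  assumes "1 < b"
  obtains n0 where "\<And>n. n0 \<le> n \<Longrightarrow> B \<le> b ^ n"
proof -
  obtain n0 where n0: "B < b ^ n0"
    using real_arch_pow[OF assms] by blast
  have "B \<le> b ^ n" if "n0 \<le> n" for n
    using n0 power_increasing[OF that, of b] assms by linarith
  then show ?thesis
    by (rule that)
qed

lemma powr_eq_power: "2 powr (a * real n) = (2 powr a) ^ n"
  by (simp add: powr_powr[symmetric] powr_realpow)

text \<open>Comparing \<open>(k + n) choose k\<close> with one term of the expansion of
  \<open>b ^ (k + n)\<close> at \<open>b - 1\<close> bounds it by \<open>D ^ k * b ^ n\<close>. As
  \<open>k\<close> is about \<open>4 * n / t\<close>, a large \<open>t\<close> makes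
  \<open>D ^ k\<close> at most \<open>D ^ 4 * b ^ n\<close>. The exponent is halved in
  \<open>b\<close> because \<open>b ^ n\<close> occurs twice.\<close>

lemma binomial_le_powr:
  fixes \<epsilon> :: real
  assumes "\<epsilon> > 0"
  obtains t c where "0 < t" "0 < c"
    "\<And>n. real ((4 * (n div t + 1) + n) choose (4 * (n div t +
        1))) \<le> c * 2 powr (\<epsilon> * real n)"
proof -
  define b where "b = 2 powr (\<epsilon> / 2)"
  have b: "b > 1"
    unfolding b_def using assms by simp
  define D where "D = b / (b - 1)"
  have D: "D > 1"
    using b by (simp add: D_def)
  obtain t0 where t0: "\<And>n. t0 \<le> n \<Longrightarrow> D ^ 4 \<le> b ^ n"
    by (rule power_eventually_ge[OF b]) blast
  define t where "t = t0 + 1"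
  have t: "t > 0" "D ^ 4 \<le> b ^ t"
    using t0[of "t0 + 1"] unfolding t_def by simp_all
  have "real ((4 * (n div t + 1) + n) choose (4 * (n div t +
      1))) \<le> D ^ 4 * 2 powr (\<epsilon> * real n)" for n
  proof -
    define k where "k = 4 * (n div t + 1)"
    have "real ((k + n) choose k) * (b - 1) ^ k \<le> b ^ (k + n)"
      using binomial_mult_power_le[of "b - 1" "k + n" k] b by simp
    then have "real ((k + n) choose k) \<le> D ^ k * b ^ n"
      using b by (simp add: D_def power_divide power_add field_simps)
    also have "D ^ k = D ^ 4 * (D ^ 4) ^ (n div t)"
      by (simp add: k_def power_add[symmetric] power_mult[symmetric])
    also have "(D ^ 4) ^ (n div t) \<le> (b ^ t) ^ (n div t)"
      using t(2) D by (intro power_mono) auto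
    also have "(b ^ t) ^ (n div t) \<le> b ^ n"
      unfolding power_mult[symmetric] using b by (intro power_increasing) auto
    finally have "real ((k + n) choose k) \<le> D ^ 4 * b ^ n * b ^ n"
      using D b by (simp add: mult_left_mono mult_right_mono)
    also have "D ^ 4 * b ^ n * b ^ n = D ^ 4 * 2 powr (\<epsilon> * real n)"
    proof -
      have "b ^ n * b ^ n = 2 powr (\<epsilon> / 2 * real n + \<epsilon> / 2 * real n)"
        unfolding b_def powr_eq_power[symmetric] by (simp only: powr_add)
      then show ?thesis by (simp add: algebra_simps)
    qed
    finally show ?thesis
      unfolding k_def .
  qed
  then show ?thesis
    using that[of t "D ^ 4"] t(1) D by simp
qed

lemma convex_subset_if_card_ge_powr:
  fixes \<epsilon> :: real
  assumes \<epsilon>: "\<epsilon> > 0"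
  shows "\<exists>n0::nat. \<forall>n\<ge>n0. \<forall>X :: (real ^ 3) set.
    finite X \<and> general_position X \<and> real (card X) \<ge> 2 powr (\<epsilon> * real n) \<longrightarrow>
    (\<exists>Y\<subseteq>X. card Y = n \<and> convex_position Y)"
proof -
  obtain t c where tc: "0 < t" "0 < c"
    "\<And>n. real ((4 * (n div t + 1) + n) choose (4 * (n div t +
        1))) \<le> c * 2 powr (\<epsilon> / 2 * real n)"
    by (rule binomial_le_powr[of "\<epsilon> / 2"]) (use \<epsilon> in auto)
  obtain N :: nat where N: "partn_lst {..<N} [3 * t + 2, 7] 5"
    using ramsey_full by blast
  obtain C where C: "0 < C" "\<And>(X :: (real^3) set) L. general_position X \<Longrightarrow>
      finite X \<Longrightarrow> 3 \<le> L \<Longrightarrow>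
     C * L \<le> card X \<Longrightarrow> \<exists>A \<sigma>. cyclic_clusters \<sigma> A N \<and>
         (\<forall>i<N. A i \<subseteq> X \<and> L \<le> card (A i))"
    using cyclic_clusters_exist[of N] by blast
  \<comment> \<open>One half of the exponent pays for the binomial coefficient, the other for the
    constants \<open>C\<close> and \<open>c\<close>.\<close>
  define b where "b = 2 powr (\<epsilon> / 2)"
  have b: "b > 1"
    unfolding b_def using \<epsilon> by simp
  obtain n0 where n0: "\<And>n. n0 \<le> n \<Longrightarrow> real C * (c + 4) \<le> b ^ n"
    by (rule power_eventually_ge[OF b]) blast
  have "\<exists>Y\<subseteq>X. card Y = n \<and> convex_position Y"
    if n: "n0 \<le> n" and X: "finite X" "general_position X"
        "real (card X) \<ge> 2 powr (\<epsilon> * real n)"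
    for n and X :: "(real^3) set"
  proof -
    define m where "m = n div t + 1"
    define y where "y = b ^ n"
    \<comment> \<open>Size 3 is what the cluster lemma demands; the successor makes the cups-caps
      bound strict.\<close>
    define L where "L = max 3 (((4 * m + n) choose (4 * m)) + 1)"
    have y: "real C * (c + 4) \<le> y" "1 \<le> y"
      using n0[OF n] b unfolding y_def by (auto intro: one_le_power)
    have "real ((4 * m + n) choose (4 * m)) \<le> c * y"
      using tc(3)[of n] unfolding m_def y_def b_def powr_eq_power .
    moreover have "c * y \<ge> 0"
      using tc(2) y(2) by simp
    ultimately have "real L \<le> c * y + 4"
      unfolding L_def by simp
    then have "real (C * L) \<le> real C * (c * y + 4)"
      by (simp add: mult_left_mono)
    also have "\<dots> \<le> real C * (c * y + 4 * y)"
      using y(2) by (intro mult_left_mono) auto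
    also have "\<dots> = (real C * (c + 4)) * y"
      by (simp add: algebra_simps)
    also have "\<dots> \<le> y * y"
      using y by (intro mult_right_mono) auto
    also have "y * y = 2 powr (\<epsilon> / 2 * real n + \<epsilon> / 2 * real n)"
      unfolding y_def b_def powr_eq_power[symmetric] by (simp only: powr_add)
    also have "\<dots> = 2 powr (\<epsilon> * real n)"
      by (simp add: algebra_simps)
    also have "\<dots> \<le> real (card X)"
      by (rule X(3))
    finally have "C * L \<le> card X"
      by (simp only: of_nat_le_iff)
    then obtain A \<sigma> where A: "cyclic_clusters \<sigma> A N" "\<And>i. i < N \<Longrightarrow>
        A i \<subseteq> X \<and> L \<le> card (A i)"
      using C(2)[OF X(2,1), of L] unfolding L_def by auto
    have "n < t * m"
      unfolding m_def using tc(1) dividend_less_times_div[of t n] by (simp add: algebra_simps)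
    then show ?thesis
      by (intro convex_subset_of_cyclic_clusters[OF X(2,1) N A(1), of m n]) (use A(2) in \<open>force simp: L_def\<close>)+
  qed
  then show ?thesis
    by blast
qed

section \<open>From large sets to the function \<open>ES\<close>\<close>

text \<open>The witness \<open>N\<close> serves both bounds: only with it is the
  \<open>LEAST\<close> in \<open>ES\<close> known to satisfy its predicate.\<close>

lemma ES_le:
  assumes "CARD('d) + 1 \<le> N"
    and "\<And>X :: (real ^ 'd::finite) set. finite X \<Longrightarrow> card X = N \<Longrightarrow>
        general_position X \<Longrightarrow>
      \<exists>Y\<subseteq>X. card Y = n \<and> convex_position Y"
  shows "CARD('d) + 1 \<le> ES TYPE('d) n" "ES TYPE('d) n \<le> N"
proof -
  let ?P = "\<lambda>N. CARD('d) + 1 \<le> N \<and> (\<forall>X :: (real ^ 'd) set. finite X \<and>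
      card X = N \<and> general_position X \<longrightarrow>
        (\<exists>Y\<subseteq>X. card Y = n \<and> convex_position Y))"
  have P: "?P N"
    using assms by blast
  show "CARD('d) + 1 \<le> ES TYPE('d) n"
    unfolding ES_def using LeastI[of ?P, OF P] by blast
  show "ES TYPE('d) n \<le> N"
    unfolding ES_def by (rule Least_le[of ?P, OF P])
qed

theorem theorem1p1:
  shows "(\<forall>\<epsilon>::real. \<epsilon> > 0 \<longrightarrow>
            (\<exists>n0::nat. \<forall>n\<ge>n0. \<forall>X :: (real ^ 3) set.
               finite X \<and> general_position X \<and>
                   real (card X) \<ge> 2 powr (\<epsilon> * real n) \<longrightarrow>
               (\<exists>Y\<subseteq>X. card Y = n \<and> convex_position Y)))
         \<and> (\<exists>f :: nat \<Rightarrow> real. f \<in> o(\<lambda>n. real n) \<and>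
               (\<forall>n. real (ES TYPE(3) n) = 2 powr f n))"
proof
  show part1: "\<forall>\<epsilon>::real. \<epsilon> > 0 \<longrightarrow>
            (\<exists>n0::nat. \<forall>n\<ge>n0. \<forall>X :: (real ^ 3) set.
               finite X \<and> general_position X \<and>
                   real (card X) \<ge> 2 powr (\<epsilon> * real n) \<longrightarrow>
               (\<exists>Y\<subseteq>X. card Y = n \<and> convex_position Y))"
    using convex_subset_if_card_ge_powr by blast
  \<comment> \<open>An integer above the real threshold, at least 4 as the definition of
    \<open>ES\<close> demands in dimension three.\<close>
  define S where "S a n = max 4 (nat \<lceil>2 powr (a * real n)\<rceil>)" for a :: real and n :: nat
  have S_ge: "2 powr (a * real n) \<le> real (S a n)" for a n
    unfolding S_def by linarith
  have S_le: "real (S a n) \<le> 2 powr (a * real n) + 5" for a n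
    unfolding S_def using powr_ge_zero[of 2 "a * real n"] by linarith
  \<comment> \<open>Admitting \<open>k\<close> above \<open>n\<close> covers small \<open>n\<close>,
    for which the asymptotic statement is silent: a subset of a larger set in convex position is
    again in convex position.\<close>
  have ES_bounds: "4 \<le> ES TYPE(3) n \<and> ES TYPE(3) n \<le> S a k"
    if k: "n \<le> k" and conv: "\<forall>X :: (real ^ 3) set. finite X \<and> general_position X \<and>
      real (card X) \<ge> 2 powr (a * real k) \<longrightarrow> (\<exists>Y\<subseteq>X. card Y =
          k \<and> convex_position Y)" for a n k
  proof -
    have sub: "\<exists>Y\<subseteq>X. card Y = n \<and> convex_position Y"
      if X: "finite X" "card X = S a k" "general_position X" for X :: "(real^3) set"
    proof -
      obtain Y where Y: "Y \<subseteq> X" "card Y = k" "convex_position Y"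
        using conv X S_ge by metis
      obtain Y' where Y': "Y' \<subseteq> Y" "card Y' = n"
        by (rule obtain_subset_with_card_n[of n Y]) (use Y k in auto)
      then show ?thesis
        using Y convex_position_subset[OF Y(3) Y'(1)] by (intro exI[of _ Y']) auto
    qed
    have "CARD(3) + 1 \<le> S a k"
      by (simp add: S_def)
    from ES_le[OF this sub] show ?thesis
      by simp
  qed
  have ES_ge: "4 \<le> ES TYPE(3) n" for n
  proof -
    obtain n0 where n0: "\<forall>n\<ge>n0. \<forall>X :: (real ^ 3) set. finite X \<and>
        general_position X \<and>
      real (card X) \<ge> 2 powr (1 * real n) \<longrightarrow> (\<exists>Y\<subseteq>X. card Y =
          n \<and> convex_position Y)"
      using part1[rule_format, of 1] by auto
    show ?thesis
      using ES_bounds[of n "max n n0" 1] n0 by simp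
  qed
  define f where "f n = log 2 (real (ES TYPE(3) n))" for n
  have f: "real (ES TYPE(3) n) = 2 powr f n" for n
    using ES_ge[of n] by (simp add: f_def)
  have "f \<in> o(\<lambda>n. real n)"
  proof (rule landau_o.smallI)
    fix c :: real
    assume c: "c > 0"
    \<comment> \<open>With half of the exponent, \<open>b ^ n + 5\<close> is at most
      \<open>b ^ n * b ^ n\<close> once \<open>b ^ n\<close> is at least 6, which absorbs the
      rounding in \<open>S\<close>.\<close>
    define b where "b = 2 powr (c / 2)"
    have b: "b > 1"
      unfolding b_def using c by simp
    obtain n1 where n1: "\<And>n. n1 \<le> n \<Longrightarrow> 6 \<le> b ^ n"
      by (rule power_eventually_ge[OF b]) blast
    obtain n0 where n0: "\<forall>n\<ge>n0. \<forall>X :: (real ^ 3) set. finite X \<and>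
        general_position X \<and>
      real (card X) \<ge> 2 powr (c / 2 * real n) \<longrightarrow> (\<exists>Y\<subseteq>X. card Y =
          n \<and> convex_position Y)"
      using part1[rule_format, of "c / 2"] c by auto
    have "norm (f n) \<le> c * norm (real n)" if n: "n \<ge> max n0 n1" for n
    proof -
      have y: "6 \<le> b ^ n"
        using n1 n by simp
      have "real (ES TYPE(3) n) \<le> real (S (c / 2) n)"
        using ES_bounds[of n n "c / 2"] n0 n by simp
      also have "\<dots> \<le> b ^ n + 5"
        using S_le[of "c / 2" n] unfolding b_def powr_eq_power .
      also have "\<dots> \<le> b ^ n * 2"
        using y by simp
      also have "\<dots> \<le> b ^ n * b ^ n"
        using y by (intro mult_left_mono) auto
      also have "\<dots> = 2 powr (c / 2 * real n + c / 2 * real n)"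
        unfolding b_def powr_eq_power[symmetric] by (simp only: powr_add)
      also have "\<dots> = 2 powr (c * real n)"
        by (simp add: algebra_simps)
      finally have "f n \<le> c * real n"
        unfolding f by simp
      moreover have "f n \<ge> 0"
        using ES_ge[of n] by (simp add: f_def)
      ultimately show ?thesis
        by simp
    qed
    then show "\<forall>\<^sub>F n in at_top. norm (f n) \<le> c * norm (real n)"
      unfolding eventually_at_top_linorder by blast
  qed
  then show "\<exists>f :: nat \<Rightarrow> real. f \<in> o(\<lambda>n. real n) \<and>
      (\<forall>n. real (ES TYPE(3) n) = 2 powr f n)"
    using f by blast
qed

end
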